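(* Let $d\ge 1$, $\pi\in(0,1)$, $\epsilon>0$, and $\mu\in\mathbb{R}^d$ with $\epsilon<\|\mu\|_2$. Let $(x,y)\in\mathbb{R}^d\times\{-1,+1\}$ be distributed with $\mathbb{P}[y=+1]=\pi$, $\mathbb{P}[y=-1]=1-\pi$, and $x\mid y\sim\mathcal{N}(y\mu,I_d)$. Let $\Delta=\{\delta\in\mathbb{R}^d:\|\delta\|_2\le\epsilon\}$, let $\mathfrak{r}$ be the uniform distribution on $\Delta$, and put $q=\ln[(1-\pi)/\pi]$. Then for every $\rho\in[0,1/2]$ the classifier $$h_p^\star(x)=\operatorname{sign}\left(x^\top\mu\left(1-\frac{v_\rho}{\|\mu\|_2}\right)_+-\frac q2\right)$$ minimizes, among all linear classifiers $h$, the probabilistically robust risk $$\mathrm{PR}(h;\rho)=\mathbb{E}_{(x,y)}\Big[\mathbb{I}\big[\mathbb{P}_{\delta\sim\mathfrak{r}}[h(x+\delta)\ne y]>\rho\big]\Big].$$ Moreover, with $h^\star_{\mathrm{Bayes}}(x)=\operatorname{sign}(x^\top\mu-q/2)$ the Bayes optimal classifier and $\mathrm{SR}(h)=\mathbb{P}_{(x,y)}[h(x)\ne y]$, as $d\to\infty$, $$\mathrm{PR}(h_p^\star;\rho)-\mathrm{SR}(h^\star_{\mathrm{Bayes}})=\begin{cases}O(1/\sqrt d), & \rho\in(0,1/2],\\ O(1), & \rho=0.\end{cases}$$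
   Context: $\mathbb{I}[\cdot]$ is the indicator of an event and $(z)_+=\max(0,z)$. A linear classifier is a map $x\mapsto\operatorname{sign}(w^\top x-c)$ with $w\in\mathbb{R}^d$, $c\in\mathbb{R}$, taking values in $\{-1,+1\}$ (the value assigned to $\operatorname{sign}(0)$ is a fixed element of $\{-1,+1\}$). For $\rho\in[0,1/2]$, $v_\rho\in[0,\epsilon]$ denotes the Euclidean distance from the origin to (the flat face of) a spherical cap of $\Delta$ with $\mathfrak{r}$-measure $\rho$: that is, for any unit vector $u$, $\mathfrak{r}(\{\delta\in\Delta: u^\top\delta\ge v_\rho\})=\rho$; in particular $v_0=\epsilon$ and $v_{1/2}=0$. The asymptotic statement refers to $d\to\infty$ with $\pi,\epsilon,\rho$ held fixed, where for each $d$ the mean $\mu=\mu_d\in\mathbb{R}^d$ is a vector with $\|\mu_d\|_2>\epsilon$. *)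

theory Defs
  imports "HOL-Probability.Probability"
begin

text \<open>
  The dimension \<open>d\<close> varies inside the statement, so \<open>\<real>\<^sup>d\<close> is modelled by the functions
  \<open>nat \<Rightarrow> real\<close> that are extensional on \<open>{..<d}\<close>, i.e. by the space of the product measure
  below.  Its Euclidean norm is \<open>\<lambda>x. L2_set x {..<d}\<close>.
\<close>

definition lborel_vec :: "nat \<Rightarrow> (nat \<Rightarrow> real) measure" where
  "lborel_vec d = (\<Pi>\<^sub>M i\<in>{..<d}. lborel)"

abbreviation vecs :: "nat \<Rightarrow> (nat \<Rightarrow> real) set" where
  "vecs d \<equiv> space (lborel_vec d)"

definition vinner :: "nat \<Rightarrow> (nat \<Rightarrow> real) \<Rightarrow> (nat \<Rightarrow> real) \<Rightarrow> real" where
  "vinner d x y = (\<Sum>i<d. x i * y i)"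

abbreviation vnorm :: "nat \<Rightarrow> (nat \<Rightarrow> real) \<Rightarrow> real" where
  "vnorm d x \<equiv> L2_set x {..<d}"

definition vadd :: "nat \<Rightarrow> (nat \<Rightarrow> real) \<Rightarrow> (nat \<Rightarrow> real) \<Rightarrow> nat \<Rightarrow> real" where
  "vadd d x y = (\<lambda>i\<in>{..<d}. x i + y i)"

definition vscale :: "nat \<Rightarrow> real \<Rightarrow> (nat \<Rightarrow> real) \<Rightarrow> nat \<Rightarrow> real" where
  "vscale d a x = (\<lambda>i\<in>{..<d}. a * x i)"

text \<open>\<open>\<N>(m, I\<^sub>d)\<close>: the coordinates are independent \<open>\<N>(m\<^sub>i, 1)\<close> because the covariance is the identity.\<close>

definition gaussian_vec :: "nat \<Rightarrow> (nat \<Rightarrow> real) \<Rightarrow> (nat \<Rightarrow> real) measure" where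
  "gaussian_vec d m = (\<Pi>\<^sub>M i\<in>{..<d}. density lborel (normal_density (m i) 1))"

definition label_pmf :: "real \<Rightarrow> int pmf" where
  "label_pmf \<pi> = map_pmf (\<lambda>b. if b then 1 else - 1) (bernoulli_pmf \<pi>)"

text \<open>The law of \<open>(x, y)\<close>: first draw \<open>y\<close>, then \<open>x\<close> from \<open>\<N>(y \<mu>, I\<^sub>d)\<close>.\<close>

definition data_dist :: "nat \<Rightarrow> real \<Rightarrow> (nat \<Rightarrow> real) \<Rightarrow> ((nat \<Rightarrow> real) \<times> int) measure" where
  "data_dist d \<pi> \<mu> =
     measure_pmf (label_pmf \<pi>) \<bind>
       (\<lambda>y. distr (gaussian_vec d (vscale d (of_int y) \<mu>))
              (lborel_vec d \<Otimes>\<^sub>M count_space UNIV) (\<lambda>x. (x, y)))"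

definition pert_ball :: "nat \<Rightarrow> real \<Rightarrow> (nat \<Rightarrow> real) set" where
  "pert_ball d \<epsilon> = {\<delta> \<in> vecs d. vnorm d \<delta> \<le> \<epsilon>}"

definition pert_dist :: "nat \<Rightarrow> real \<Rightarrow> (nat \<Rightarrow> real) measure" where
  "pert_dist d \<epsilon> = uniform_measure (lborel_vec d) (pert_ball d \<epsilon>)"

definition cap_dist :: "nat \<Rightarrow> real \<Rightarrow> real \<Rightarrow> real" where
  "cap_dist d \<epsilon> \<rho> =
     (THE v. 0 \<le> v \<and> v \<le> \<epsilon> \<and>
        (\<forall>u\<in>vecs d. vnorm d u = 1 \<longrightarrow>
           measure (pert_dist d \<epsilon>) {\<delta> \<in> pert_ball d \<epsilon>. vinner d u \<delta> \<ge> v} = \<rho>))"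

text \<open>The sign function whose value at \<open>0\<close> is the parameter \<open>s\<^sub>0\<close>.\<close>

definition sign :: "int \<Rightarrow> real \<Rightarrow> int" where
  "sign s\<^sub>0 z = (if z > 0 then 1 else if z < 0 then - 1 else s\<^sub>0)"

definition linear_classifiers :: "int \<Rightarrow> nat \<Rightarrow> ((nat \<Rightarrow> real) \<Rightarrow> int) set" where
  "linear_classifiers s\<^sub>0 d = {\<lambda>x. sign s\<^sub>0 (vinner d w x - c) | w c. w \<in> vecs d}"

definition PR :: "nat \<Rightarrow> real \<Rightarrow> real \<Rightarrow> (nat \<Rightarrow> real) \<Rightarrow> ((nat \<Rightarrow> real) \<Rightarrow> int) \<Rightarrow> real \<Rightarrow> real" where
  "PR d \<pi> \<epsilon> \<mu> h \<rho> =
     (\<integral>(x, y). of_bool (measure (pert_dist d \<epsilon>) {\<delta> \<in> vecs d. h (vadd d x \<delta>) \<noteq> y} > \<rho>)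
        \<partial>data_dist d \<pi> \<mu>)"

definition SR :: "nat \<Rightarrow> real \<Rightarrow> (nat \<Rightarrow> real) \<Rightarrow> ((nat \<Rightarrow> real) \<Rightarrow> int) \<Rightarrow> real" where
  "SR d \<pi> \<mu> h = measure (data_dist d \<pi> \<mu>) {(x, y) \<in> space (data_dist d \<pi> \<mu>). h x \<noteq> y}"

definition log_odds :: "real \<Rightarrow> real" where
  "log_odds \<pi> = ln ((1 - \<pi>) / \<pi>)"

definition h_p :: "int \<Rightarrow> nat \<Rightarrow> real \<Rightarrow> real \<Rightarrow> (nat \<Rightarrow> real) \<Rightarrow> real \<Rightarrow> (nat \<Rightarrow> real) \<Rightarrow> int" where
  "h_p s\<^sub>0 d \<pi> \<epsilon> \<mu> \<rho> x =
     sign s\<^sub>0 (vinner d x \<mu> * max 0 (1 - cap_dist d \<epsilon> \<rho> / vnorm d \<mu>) - log_odds \<pi> / 2)"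

definition h_Bayes :: "int \<Rightarrow> nat \<Rightarrow> real \<Rightarrow> (nat \<Rightarrow> real) \<Rightarrow> (nat \<Rightarrow> real) \<Rightarrow> int" where
  "h_Bayes s\<^sub>0 d \<pi> \<mu> x = sign s\<^sub>0 (vinner d x \<mu> - log_odds \<pi> / 2)"

end

theory Submission
  imports Defs
begin

text \<open>
  Perturbing \<open>x\<close> uniformly in the ball moves \<open>w\<^sup>T x - c\<close> by \<open>\<parallel>w\<parallel>\<close> times a variable whose law does
  not depend on \<open>w\<close>, is symmetric and has no atoms. Hence the event inside the robust risk is that
  \<open>y (w\<^sup>T x - c) < v\<^sub>\<rho> \<parallel>w\<parallel>\<close>, and the robust risk of a linear classifier equals
  \<open>\<pi> \<Phi>(c' - a) + (1 - \<pi>) \<Phi>(- c' - a)\<close> with \<open>c' = c / \<parallel>w\<parallel>\<close> and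
  \<open>a = w\<^sup>T \<mu> / \<parallel>w\<parallel> - v\<^sub>\<rho> \<le> \<parallel>\<mu>\<parallel> - v\<^sub>\<rho>\<close>. This decreases in \<open>a\<close>, and for a fixed \<open>a > 0\<close> it is the
  standard risk of a linear classifier for a mean of norm \<open>a\<close>, so that the Bayes classifier for that
  mean tells the optimal \<open>c'\<close>. Since the formula is 1-Lipschitz in \<open>a\<close>, passing to the robust risk
  costs at most \<open>v\<^sub>\<rho>\<close>. Finally \<open>d \<rho> v\<^sub>\<rho>\<^sup>2 \<le> \<epsilon>\<^sup>2\<close>, because the squared coordinates of a point of the
  ball sum to at most \<open>\<epsilon>\<^sup>2\<close>.
\<close>

section \<open>Vectors and their Lebesgue measure\<close>

lemma space_lborel_vec: "space (lborel_vec d) = {..<d} \<rightarrow>\<^sub>E UNIV"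
  by (simp add: lborel_vec_def space_PiM)

lemma sq_vnorm: "(vnorm d x)\<^sup>2 = (\<Sum>i<d. (x i)\<^sup>2)"
  by (simp add: L2_set_def sum_nonneg)

lemma abs_component_le_vnorm:
  assumes "i < d"
  shows "\<bar>x i\<bar> \<le> vnorm d x"
proof -
  have "(x i)\<^sup>2 \<le> (vnorm d x)\<^sup>2"
    unfolding sq_vnorm using assms by (intro member_le_sum) auto
  then show ?thesis by (metis L2_set_nonneg abs_le_square_iff abs_of_nonneg)
qed

lemma vinner_commute: "vinner d x y = vinner d y x"
  by (simp add: vinner_def mult.commute)

lemma vinner_vscale: "vinner d w (vscale d a x) = a * vinner d w x"
  by (simp add: vinner_def vscale_def sum_distrib_left mult_ac)

lemma vinner_self: "vinner d x x = (vnorm d x)\<^sup>2"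
  by (simp add: vinner_def L2_set_def sum_nonneg power2_eq_square)

lemma vinner_vadd: "vinner d w (vadd d x \<delta>) = vinner d w x + vinner d w \<delta>"
  by (simp add: vinner_def vadd_def sum.distrib[symmetric] distrib_left)

lemma vinner_le_vnorm: "vinner d x y \<le> vnorm d x * vnorm d y"
proof -
  have "vinner d x y \<le> (\<Sum>i<d. \<bar>x i\<bar> * \<bar>y i\<bar>)"
    unfolding vinner_def by (intro sum_mono) (metis abs_ge_self abs_mult)
  also have "\<dots> \<le> vnorm d x * vnorm d y" by (rule L2_set_mult_ineq)
  finally show ?thesis .
qed

lemma vinner_eq_0:
  assumes "vnorm d w = 0"
  shows "vinner d w x = 0"
proof -
  have "w i = 0" if "i < d" for i
    using assms that by (simp add: L2_set_eq_0_iff)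
  then show ?thesis by (simp add: vinner_def)
qed

lemma vnorm_vscale: "vnorm d (vscale d a x) = \<bar>a\<bar> * vnorm d x"
proof -
  have "vnorm d (vscale d a x) = L2_set (\<lambda>i. a * x i) {..<d}"
    by (intro L2_set_cong) (auto simp: vscale_def)
  then show ?thesis
    by (simp add: L2_set_def power_mult_distrib sum_distrib_left[symmetric] real_sqrt_mult)
qed

lemma vscale_vecs: "vscale d a x \<in> vecs d"
  by (simp add: space_lborel_vec vscale_def)

text \<open>Makes Fubini and the box volumes available for \<open>lborel_vec\<close>, a finite
  product of Lebesgue measures.\<close>

interpretation lebesgue_product: product_sigma_finite "\<lambda>_::nat. lborel :: real measure"
  by standard

lemma sets_lborel_vec [measurable_cong]: "sets (lborel_vec d) = sets (\<Pi>\<^sub>M i\<in>{..<d}. borel)"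
  unfolding lborel_vec_def by (intro sets_PiM_cong) auto

lemma measurable_lborel_vec_component:
  assumes "i < d"
  shows "(\<lambda>x. x i) \<in> borel_measurable (lborel_vec d)"
proof -
  have "(\<lambda>x. x i) \<in> lborel_vec d \<rightarrow>\<^sub>M lborel"
    unfolding lborel_vec_def using assms by (intro measurable_component_singleton) simp
  then show ?thesis by simp
qed

lemma measurable_vinner [measurable]: "vinner d w \<in> borel_measurable (lborel_vec d)"
  unfolding vinner_def[abs_def] lborel_vec_def by measurable

lemma measurable_vnorm [measurable]: "vnorm d \<in> borel_measurable (lborel_vec d)"
  unfolding L2_set_def[abs_def] lborel_vec_def by measurable

section \<open>Rotation invariance\<close>

text \<open>Fubini: with the other coordinates fixed, only coordinate \<open>i\<close> moves, by an
  affine map of slope \<open>s\<close>, and this preserves one-dimensional Lebesgue measure since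
  \<open>\<bar>s\<bar> = 1\<close>. The value \<open>s = 1\<close> gives shears,
  \<open>s = -1\<close> reflections.\<close>

lemma distr_shear_lborel_vec:
  fixes s :: real
  assumes i: "i < d" and s: "\<bar>s\<bar> = 1"
    and g [measurable]: "g \<in> borel_measurable (lborel_vec d)"
    and indep: "\<And>x y. g (x(i := y)) = g x"
  shows "(\<lambda>x. x(i := s * x i + g x)) \<in> lborel_vec d \<rightarrow>\<^sub>M lborel_vec d"
    and "distr (lborel_vec d) (lborel_vec d) (\<lambda>x. x(i := s * x i + g x)) = lborel_vec d"
proof -
  let ?M = "lborel_vec d" and ?T = "\<lambda>x. x(i := s * x i + g x)"
  define J where "J = {..<d} - {i}"
  have J: "{..<d} = insert i J" "i \<notin> J" "finite J" using i by (auto simp: J_def)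
  have M_eq: "?M = Pi\<^sub>M (insert i J) (\<lambda>_. lborel)"
    by (simp add: lborel_vec_def J(1))
  have i_meas [measurable]: "(\<lambda>x. x i) \<in> borel_measurable ?M"
    using i by (rule measurable_lborel_vec_component)
  show T [measurable]: "?T \<in> ?M \<rightarrow>\<^sub>M ?M"
    unfolding lborel_vec_def
  proof (rule measurable_fun_upd)
    show "{..<d} = {..<d} \<union> {i}" using i by auto
    show "(\<lambda>x. x) \<in> Pi\<^sub>M {..<d} (\<lambda>i. lborel) \<rightarrow>\<^sub>M Pi\<^sub>M {..<d} (\<lambda>i. lborel)" by simp
    show "(\<lambda>x. s * x i + g x) \<in> Pi\<^sub>M {..<d} (\<lambda>i. lborel) \<rightarrow>\<^sub>M lborel"
      unfolding lborel_vec_def[symmetric] by measurable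
  qed
  show "distr ?M ?M ?T = ?M"
  proof (rule measure_eqI)
    show "sets (distr ?M ?M ?T) = sets ?M" by simp
    fix A assume "A \<in> sets (distr ?M ?M ?T)"
    then have A [measurable]: "A \<in> sets ?M" by simp
    have meas: "(\<lambda>x. indicator A (?T x) :: ennreal) \<in> borel_measurable (Pi\<^sub>M (insert i J) (\<lambda>_. lborel))"
      unfolding M_eq[symmetric] by measurable
    have measA: "(\<lambda>x. indicator A x :: ennreal) \<in> borel_measurable (Pi\<^sub>M (insert i J) (\<lambda>_. lborel))"
      unfolding M_eq[symmetric] by measurable
    have "emeasure (distr ?M ?M ?T) A = (\<integral>\<^sup>+x. indicator A x \<partial>distr ?M ?M ?T)" by simp
    also have "\<dots> = (\<integral>\<^sup>+x. indicator A (?T x) \<partial>Pi\<^sub>M (insert i J) (\<lambda>_. lborel))"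
      unfolding M_eq[symmetric] by (rule nn_integral_distr) measurable
    also have "\<dots> = (\<integral>\<^sup>+x. \<integral>\<^sup>+y. indicator A (?T (x(i := y))) \<partial>lborel \<partial>Pi\<^sub>M J (\<lambda>_. lborel))"
      by (rule lebesgue_product.product_nn_integral_insert[OF J(3,2) meas])
    also have "\<dots> = (\<integral>\<^sup>+x. \<integral>\<^sup>+y. indicator A (x(i := y)) \<partial>lborel \<partial>Pi\<^sub>M J (\<lambda>_. lborel))"
    proof (rule nn_integral_cong)
      fix x assume x: "x \<in> space (Pi\<^sub>M J (\<lambda>_. lborel :: real measure))"
      have [measurable]: "(\<lambda>y. indicator A (x(i := y)) :: ennreal) \<in> borel_measurable borel"
      proof -
        have "(\<lambda>y. x(i := y)) \<in> borel \<rightarrow>\<^sub>M ?M"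
          unfolding M_eq using x J(2) by (intro measurable_fun_upd[where J=J]) auto
        from measurable_compose[OF this borel_measurable_indicator[OF A]] show ?thesis .
      qed
      have "(\<integral>\<^sup>+y. indicator A (x(i := y)) \<partial>lborel) = (\<integral>\<^sup>+y. indicator A (x(i := g x + s * y)) \<partial>lborel)"
        using s by (subst nn_integral_real_affine[where c=s and t="g x"]) auto
      then show "(\<integral>\<^sup>+y. indicator A (?T (x(i := y))) \<partial>lborel) = (\<integral>\<^sup>+y. indicator A (x(i := y)) \<partial>lborel :: ennreal)"
        by (simp add: indep add.commute)
    qed
    also have "\<dots> = (\<integral>\<^sup>+x. indicator A x \<partial>Pi\<^sub>M (insert i J) (\<lambda>_. lborel))"
      by (rule lebesgue_product.product_nn_integral_insert[OF J(3,2) measA, symmetric])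
    finally show "emeasure (distr ?M ?M ?T) A = emeasure ?M A"
      using A unfolding M_eq[symmetric] by simp
  qed
qed

definition volume_preserving :: "nat \<Rightarrow> ((nat \<Rightarrow> real) \<Rightarrow> nat \<Rightarrow> real) \<Rightarrow> bool" where
  "volume_preserving d T \<longleftrightarrow>
     T \<in> lborel_vec d \<rightarrow>\<^sub>M lborel_vec d \<and> distr (lborel_vec d) (lborel_vec d) T = lborel_vec d"

lemma volume_preserving_comp:
  assumes "volume_preserving d S" "volume_preserving d T"
  shows "volume_preserving d (S \<circ> T)"
  using assms unfolding volume_preserving_def
  by (metis distr_distr measurable_comp)

text \<open>One shear is added per element of \<open>J\<close>. Coordinate 0 lies outside
  \<open>J\<close>, so every shear reads the same \<open>x 0\<close> and the composition is the
  simultaneous shift.\<close>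

lemma volume_preserving_shift:
  assumes "J \<subseteq> {0<..<d}"
  shows "volume_preserving d (\<lambda>x i. if i \<in> J then x i + r i * x 0 else x i)"
proof -
  have "finite J" using assms finite_subset by blast
  then show ?thesis using assms
  proof (induction J rule: finite_induct)
    case empty
    then show ?case by (simp add: volume_preserving_def distr_id2)
  next
    case (insert j J)
    let ?S = "\<lambda>x i. if i \<in> J then x i + r i * x 0 else x i"
    let ?T = "\<lambda>x. x(j := 1 * x j + r j * x 0)"
    have j: "0 < j" "j < d" using insert.prems by auto
    have [measurable]: "(\<lambda>x. x 0) \<in> borel_measurable (lborel_vec d)"
      using j by (intro measurable_lborel_vec_component) auto
    have "volume_preserving d ?T"
      unfolding volume_preserving_def using j
      by (intro conjI distr_shear_lborel_vec) auto
    moreover have "volume_preserving d ?S" using insert by auto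
    ultimately have "volume_preserving d (?T \<circ> ?S)" by (rule volume_preserving_comp)
    moreover have "?T \<circ> ?S = (\<lambda>x i. if i \<in> insert j J then x i + r i * x 0 else x i)"
      using insert.hyps insert.prems by (auto simp: fun_eq_iff)
    ultimately show ?case by simp
  qed
qed

text \<open>Three shears compose to an orthogonal map taking the first basis vector to \<open>u\<close>, like the
  decomposition of a planar rotation by \<open>\<theta>\<close> into shears with slopes \<open>- tan (\<theta>/2)\<close>, \<open>sin \<theta>\<close>,
  \<open>- tan (\<theta>/2)\<close>. Only \<open>\<theta> = \<pi>\<close> needs a reflection instead.\<close>

lemma obtain_rotation:
  assumes d: "d \<ge> 1" and u: "vnorm d u = 1"
  obtains T where "volume_preserving d T" "\<And>x. vnorm d (T x) = vnorm d x" "\<And>x. vinner d u (T x) = x 0"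
proof -
  define I where "I = {0<..<d}"
  have I: "{..<d} = insert 0 I" "0 \<notin> I" "finite I" using d by (auto simp: I_def)
  have sum_I: "(\<Sum>i<d. f i) = f 0 + (\<Sum>i\<in>I. f i)" for f :: "nat \<Rightarrow> real"
    using I by simp
  \<comment> \<open>With \<open>u 0 = cos \<theta>\<close> this is the square of
    \<open>sin \<theta>\<close>, the squared length of the part of \<open>u\<close> orthogonal to
    the first basis vector.\<close>
  define n where "n = (\<Sum>i\<in>I. u i * u i)"
  have "(\<Sum>i<d. u i * u i) = 1"
    using u by (simp add: L2_set_def power2_eq_square)
  then have n: "n = 1 - u 0 * u 0" unfolding sum_I n_def by simp
  have norm_eq: "vnorm d y = vnorm d x" if "(\<Sum>i<d. y i * y i) = (\<Sum>i<d. x i * x i)" for x y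
    using that by (simp add: L2_set_def power2_eq_square)
  have meas0 [measurable]: "(\<lambda>x. x 0) \<in> borel_measurable (lborel_vec d)"
    using d by (intro measurable_lborel_vec_component) auto
  show ?thesis
  proof (cases "u 0 = -1")
    case True
    then have "n = 0" using n by simp
    then have u0: "u i = 0" if "i \<in> I" for i
      using that I(3) unfolding n_def by (subst (asm) sum_nonneg_eq_0_iff) auto
    \<comment> \<open>Here \<open>u\<close> is minus the first basis vector and the quotient by
      \<open>1 + u 0\<close> used in the other case breaks down; negating coordinate 0 takes the
      place of the rotation.\<close>
    let ?T = "\<lambda>x. x(0 := (-1) * x 0 + 0) :: nat \<Rightarrow> real"
    have "volume_preserving d ?T"
      unfolding volume_preserving_def using d
      by (intro conjI distr_shear_lborel_vec) auto
    moreover have "vnorm d (?T x) = vnorm d x" for x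
      using I(2) by (intro norm_eq) (auto simp: sum_I intro!: sum.cong)
    moreover have "vinner d u (?T x) = x 0" for x
      unfolding vinner_def sum_I using u0 True by simp
    ultimately show ?thesis by (rule that)
  next
    case False
    define p where "p x = (\<Sum>i\<in>I. u i * x i)" for x
    have p_upd [simp]: "p (x(0 := y)) = p x" for x y
      unfolding p_def using I(2) by (auto intro!: sum.cong)
    have [measurable]: "p \<in> borel_measurable (lborel_vec d)"
      unfolding p_def[abs_def]
      by (intro borel_measurable_sum borel_measurable_times borel_measurable_const measurable_lborel_vec_component)
         (auto simp: I_def)
    \<comment> \<open>\<open>S\<close> and \<open>R\<close> are the shears of slopes
      \<open>- tan (\<theta>/2)\<close> and \<open>sin \<theta>\<close>: the quotient by
      \<open>1 + u 0\<close> comes from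
      \<open>tan (\<theta>/2) = sin \<theta> / (1 + cos \<theta>)\<close>, and \<open>p\<close>
      carries the factor \<open>sin \<theta>\<close>.\<close>
    define S where "S = (\<lambda>x. x(0 := 1 * x 0 + (- p x / (1 + u 0))))"
    define R where "R = (\<lambda>x i. if i \<in> I then x i + u i * x 0 else x i)"
    have S: "S x 0 = x 0 - p x / (1 + u 0)" "p (S x) = p x" "i \<in> I \<Longrightarrow> S x i = x i" for x i
      using I(2) unfolding S_def by auto
    have R: "R x 0 = x 0" "i \<in> I \<Longrightarrow> R x i = x i + u i * x 0" for x i
      using I(2) unfolding R_def by auto
    have "volume_preserving d S"
      unfolding volume_preserving_def S_def using d
      by (intro conjI distr_shear_lborel_vec) auto
    moreover have "volume_preserving d R"
      unfolding R_def by (rule volume_preserving_shift) (simp add: I_def)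
    ultimately have vp: "volume_preserving d (S \<circ> (R \<circ> S))"
      by (intro volume_preserving_comp)
    define T where "T = S \<circ> (R \<circ> S)"
    have ne: "1 + u 0 \<noteq> 0" using False by linarith
    have T_I: "T x i = x i + u i * (x 0 - p x / (1 + u 0))" if "i \<in> I" for x i
      using that by (simp add: T_def S R)
    have pR: "p (R x) = p x + n * x 0" for x
    proof -
      have "p (R x) = (\<Sum>i\<in>I. u i * x i + u i * u i * x 0)"
        unfolding p_def by (intro sum.cong) (auto simp: R algebra_simps)
      then show ?thesis by (simp add: sum.distrib sum_distrib_right p_def n_def)
    qed
    have T_0: "T x 0 = u 0 * x 0 - p x" for x
    proof -
      \<comment> \<open>\<open>k\<close> is coordinate 0 after the first shear; writing
        \<open>p x\<close> in terms of \<open>k\<close> removes the division.\<close>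
      define k where "k = x 0 - p x / (1 + u 0)"
      have px: "p x = (x 0 - k) * (1 + u 0)" using ne by (simp add: k_def)
      have "T x 0 = k - (p x + n * k) / (1 + u 0)"
        by (simp add: T_def S R pR k_def)
      also have "p x + n * k = (x 0 - u 0 * k) * (1 + u 0)"
        unfolding n px by (simp add: algebra_simps)
      also have "k - \<dots> / (1 + u 0) = k - (x 0 - u 0 * k)" using ne by simp
      also have "\<dots> = u 0 * x 0 - p x" unfolding px by (simp add: algebra_simps)
      finally show ?thesis .
    qed
    have sum_pT: "(\<Sum>i\<in>I. u i * T x i) = p x + n * (x 0 - p x / (1 + u 0))" for x
    proof -
      define k where "k = x 0 - p x / (1 + u 0)"
      have "(\<Sum>i\<in>I. u i * T x i) = (\<Sum>i\<in>I. u i * x i + u i * u i * k)"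
        by (intro sum.cong) (auto simp: T_I k_def[symmetric] algebra_simps)
      then show ?thesis by (simp add: sum.distrib sum_distrib_right p_def n_def k_def)
    qed
    have n': "n = (1 - u 0) * (1 + u 0)" unfolding n by (simp add: algebra_simps)
    have "vnorm d (T x) = vnorm d x" for x
    proof (rule norm_eq)
      define k where "k = x 0 - p x / (1 + u 0)"
      have px: "p x = (x 0 - k) * (1 + u 0)" using ne by (simp add: k_def)
      have "(\<Sum>i\<in>I. T x i * T x i) = (\<Sum>i\<in>I. x i * x i + 2 * k * (u i * x i) + k * k * (u i * u i))"
        by (intro sum.cong) (auto simp: T_I k_def[symmetric] algebra_simps)
      also have "\<dots> = (\<Sum>i\<in>I. x i * x i) + 2 * k * p x + k * k * n"
        by (simp add: sum.distrib sum_distrib_left p_def n_def)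
      finally have "(\<Sum>i<d. T x i * T x i)
          = (u 0 * x 0 - p x) * (u 0 * x 0 - p x) + ((\<Sum>i\<in>I. x i * x i) + 2 * k * p x + k * k * n)"
        unfolding sum_I T_0 by simp
      also have "\<dots> = x 0 * x 0 + (\<Sum>i\<in>I. x i * x i)"
        unfolding px n by (simp add: algebra_simps)
      finally show "(\<Sum>i<d. T x i * T x i) = (\<Sum>i<d. x i * x i)" unfolding sum_I .
    qed
    moreover have "vinner d u (T x) = x 0" for x
    proof -
      have "vinner d u (T x) = u 0 * (u 0 * x 0 - p x) + (p x + n * (x 0 - p x / (1 + u 0)))"
        unfolding vinner_def sum_I T_0 sum_pT ..
      also have "n * (x 0 - p x / (1 + u 0)) = n * x 0 - (1 - u 0) * p x"
        unfolding n' using ne by (simp add: right_diff_distrib)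
      finally show ?thesis unfolding n by (simp add: algebra_simps)
    qed
    ultimately show ?thesis using that vp unfolding T_def by blast
  qed
qed

section \<open>Spherical caps\<close>

lemma pert_ball_sets [measurable]: "pert_ball d \<epsilon> \<in> sets (lborel_vec d)"
  unfolding pert_ball_def by measurable

lemma sets_pert_dist [measurable_cong]: "sets (pert_dist d \<epsilon>) = sets (lborel_vec d)"
  and space_pert_dist: "space (pert_dist d \<epsilon>) = vecs d"
  by (simp_all add: pert_dist_def)

lemma emeasure_lborel_vec_box:
  assumes "\<And>i. i < d \<Longrightarrow> A i \<in> sets borel"
  shows "emeasure (lborel_vec d) (Pi\<^sub>E {..<d} A) = (\<Prod>i<d. emeasure lborel (A i))"
  unfolding lborel_vec_def by (rule lebesgue_product.emeasure_PiM) (use assms in auto)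

lemma lborel_vec_box_sets:
  assumes "\<And>i. i < d \<Longrightarrow> A i \<in> sets (borel :: real measure)"
  shows "(Pi\<^sub>E {..<d} A) \<in> sets (lborel_vec d)"
  unfolding lborel_vec_def by (rule sets_PiM_I_finite) (use assms in auto)

text \<open>The strip contains a box of positive volume: coordinate 0 ranges over an interval
  strictly inside both the strip and the ball, and the other coordinates are kept so small that the
  norm stays at most \<epsilon>.\<close>

lemma emeasure_strip_pert_ball_pos:
  assumes d: "d \<ge> 1" and pq: "p < q" "- \<epsilon> < q" "q \<le> \<epsilon>"
  shows "emeasure (lborel_vec d) {x \<in> pert_ball d \<epsilon>. p < x 0 \<and> x 0 < q} > 0"
proof -
  \<comment> \<open>The truncation handles \<open>p < - \<epsilon>\<close>; \<open>a\<close> and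
    \<open>b\<close> then cut the interval from \<open>p0\<close> to \<open>q\<close> into
    thirds.\<close>
  define p0 where "p0 = max p (- \<epsilon>)"
  define a where "a = (2 * p0 + q) / 3"
  define b where "b = (p0 + 2 * q) / 3"
  have ab: "p < a" "a < b" "b < q" "- \<epsilon> < a" "b < \<epsilon>"
    using pq unfolding a_def b_def p0_def by (auto simp: max_def field_simps split: if_splits)
  define r where "r = max \<bar>a\<bar> \<bar>b\<bar>"
  have r: "0 \<le> r" "r < \<epsilon>" using ab by (auto simp: r_def)
  then have "r\<^sup>2 < \<epsilon>\<^sup>2" by (intro power_strict_mono) auto
  \<comment> \<open>Chosen so that
    \<open>r\<^sup>2 + d * \<eta>\<^sup>2 = \<epsilon>\<^sup>2\<close>, where \<open>r\<close>
    bounds coordinate 0 and \<open>\<eta>\<close> each of the others.\<close>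
  define \<eta> where "\<eta> = sqrt ((\<epsilon>\<^sup>2 - r\<^sup>2) / d)"
  have \<eta>: "\<eta> > 0" "real d * \<eta>\<^sup>2 = \<epsilon>\<^sup>2 - r\<^sup>2"
    using \<open>r\<^sup>2 < \<epsilon>\<^sup>2\<close> d unfolding \<eta>_def by auto
  define A where "A i = (if i = 0 then {a..b} else {-\<eta>..\<eta>})" for i :: nat
  have "(Pi\<^sub>E {..<d} A) \<subseteq> {x \<in> pert_ball d \<epsilon>. p < x 0 \<and> x 0 < q}"
  proof
    fix x assume x: "x \<in> Pi\<^sub>E {..<d} A"
    then have xA: "x i \<in> A i" if "i < d" for i using that by auto
    have x0: "a \<le> x 0" "x 0 \<le> b" using xA[of 0] d by (auto simp: A_def)
    have "(x i)\<^sup>2 \<le> (if i = 0 then r\<^sup>2 else 0) + \<eta>\<^sup>2" if i: "i < d" for i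
    proof (cases "i = 0")
      case True
      have "\<bar>x 0\<bar> \<le> r" using x0 by (auto simp: r_def)
      then have "(x 0)\<^sup>2 \<le> r\<^sup>2" using r(1) by (metis abs_le_square_iff abs_of_nonneg)
      then show ?thesis using True by (simp add: add_increasing2)
    next
      case False
      then have "\<bar>x i\<bar> \<le> \<eta>" using xA[OF i] by (auto simp: A_def)
      then have "(x i)\<^sup>2 \<le> \<eta>\<^sup>2" using \<eta>(1) by (metis abs_le_square_iff abs_of_pos)
      then show ?thesis using False by simp
    qed
    then have "(vnorm d x)\<^sup>2 \<le> (\<Sum>i<d. (if i = 0 then r\<^sup>2 else 0) + \<eta>\<^sup>2)"
      unfolding sq_vnorm by (intro sum_mono) auto
    also have "\<dots> = \<epsilon>\<^sup>2" using d \<eta>(2) by (simp add: sum.distrib)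
    finally have "vnorm d x \<le> \<epsilon>" using r by (simp add: power2_le_iff_abs_le)
    then show "x \<in> {x \<in> pert_ball d \<epsilon>. p < x 0 \<and> x 0 < q}"
      using x x0 ab by (auto simp: pert_ball_def space_lborel_vec)
  qed
  moreover have "emeasure (lborel_vec d) (Pi\<^sub>E {..<d} A) > 0"
  proof -
    have "emeasure (lborel_vec d) (Pi\<^sub>E {..<d} A) = (\<Prod>i<d. emeasure lborel (A i))"
      by (rule emeasure_lborel_vec_box) (auto simp: A_def)
    also have "\<dots> \<noteq> 0" using ab \<eta>(1) by (auto simp: A_def prod_zero_iff)
    finally show ?thesis by (simp add: zero_less_iff_neq_zero)
  qed
  moreover have "{x \<in> pert_ball d \<epsilon>. p < x 0 \<and> x 0 < q} \<in> sets (lborel_vec d)"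
  proof -
    have [measurable]: "(\<lambda>x. x 0) \<in> borel_measurable (lborel_vec d)"
      using d by (intro measurable_lborel_vec_component) auto
    have "{x \<in> space (lborel_vec d). x \<in> pert_ball d \<epsilon> \<and> p < x 0 \<and> x 0 < q} \<in> sets (lborel_vec d)"
      by measurable
    also have "{x \<in> space (lborel_vec d). x \<in> pert_ball d \<epsilon> \<and> p < x 0 \<and> x 0 < q} = {x \<in> pert_ball d \<epsilon>. p < x 0 \<and> x 0 < q}"
      by (auto simp: pert_ball_def)
    finally show ?thesis .
  qed
  ultimately show ?thesis by (meson emeasure_mono less_le_trans)
qed

lemma emeasure_pert_ball_pos:
  assumes "d \<ge> 1" "\<epsilon> > 0"
  shows "emeasure (lborel_vec d) (pert_ball d \<epsilon>) > 0"
proof -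
  have "0 < emeasure (lborel_vec d) {x \<in> pert_ball d \<epsilon>. 0 < x 0 \<and> x 0 < \<epsilon>}"
    using assms by (intro emeasure_strip_pert_ball_pos) auto
  also have "\<dots> \<le> emeasure (lborel_vec d) (pert_ball d \<epsilon>)"
    by (intro emeasure_mono) auto
  finally show ?thesis .
qed

lemma emeasure_pert_ball_finite: "emeasure (lborel_vec d) (pert_ball d \<epsilon>) < \<infinity>"
proof -
  have "pert_ball d \<epsilon> \<subseteq> Pi\<^sub>E {..<d} (\<lambda>_. {-\<epsilon>..\<epsilon>})"
  proof
    fix x assume x: "x \<in> pert_ball d \<epsilon>"
    have "\<bar>x i\<bar> \<le> \<epsilon>" if "i < d" for i
      using abs_component_le_vnorm[OF that, of x] x by (simp add: pert_ball_def)
    then show "x \<in> Pi\<^sub>E {..<d} (\<lambda>_. {-\<epsilon>..\<epsilon>})"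
      using x by (fastforce simp: pert_ball_def space_lborel_vec abs_le_iff)
  qed
  then have "emeasure (lborel_vec d) (pert_ball d \<epsilon>) \<le> emeasure (lborel_vec d) (Pi\<^sub>E {..<d} (\<lambda>_. {-\<epsilon>..\<epsilon>}))"
    by (intro emeasure_mono lborel_vec_box_sets) auto
  also have "\<dots> = (\<Prod>i<d. emeasure lborel {-\<epsilon>..\<epsilon>})"
    by (rule emeasure_lborel_vec_box) auto
  also have "\<dots> < \<infinity>"
    by (cases "- \<epsilon> \<le> \<epsilon>") (auto simp: power_less_top_ennreal)
  finally show ?thesis .
qed

lemma prob_space_pert_dist:
  assumes "d \<ge> 1" "\<epsilon> > 0"
  shows "prob_space (pert_dist d \<epsilon>)"
  unfolding pert_dist_def
  using emeasure_pert_ball_pos[OF assms] emeasure_pert_ball_finite[of d \<epsilon>]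
  by (intro prob_space_uniform_measure) auto

lemma emeasure_lborel_vec_hyperplane:
  assumes d: "d \<ge> 1"
  shows "emeasure (lborel_vec d) {x \<in> vecs d. x 0 = v} = 0"
proof -
  define A where "A i = (if i = 0 then {v} else UNIV)" for i :: nat
  have "{x \<in> vecs d. x 0 = v} = Pi\<^sub>E {..<d} A"
    using d by (fastforce simp: space_lborel_vec PiE_iff extensional_def A_def split: if_splits)
  also have "emeasure (lborel_vec d) \<dots> = (\<Prod>i<d. emeasure lborel (A i))"
    by (rule emeasure_lborel_vec_box) (simp add: A_def)
  \<comment> \<open>The side \<open>{v}\<close> contributes the factor 0, which absorbs the infinite
    sides because \<open>0 * \<infinity> = 0\<close> in \<open>ennreal\<close>.\<close>
  also have "\<dots> = 0" using d by (intro prod_zero) (auto simp: A_def)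
  finally show ?thesis .
qed

section \<open>The one-dimensional marginal of the uniform law on the ball\<close>

definition pert_marginal :: "nat \<Rightarrow> real \<Rightarrow> real measure" where
  "pert_marginal d \<epsilon> = distr (pert_dist d \<epsilon>) borel (\<lambda>\<delta>. \<delta> 0)"

text \<open>A rotation taking the first basis vector to \<open>u\<close> preserves both the volume
  and the ball, and it turns \<open>vinner d u\<close> into coordinate 0.\<close>

lemma distr_pert_dist_vinner:
  assumes d: "d \<ge> 1" and u: "vnorm d u = 1"
  shows "distr (pert_dist d \<epsilon>) borel (vinner d u) = pert_marginal d \<epsilon>"
proof -
  let ?L = "lborel_vec d" and ?B = "pert_ball d \<epsilon>"
  obtain T where T: "volume_preserving d T" "\<And>x. vnorm d (T x) = vnorm d x" "\<And>x. vinner d u (T x) = x 0"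
    using obtain_rotation[OF d u] by blast
  then have T_meas [measurable]: "T \<in> ?L \<rightarrow>\<^sub>M ?L" and T_distr: "distr ?L ?L T = ?L"
    by (auto simp: volume_preserving_def)
  have [measurable]: "(\<lambda>x. x 0) \<in> borel_measurable ?L"
    using d by (intro measurable_lborel_vec_component) auto
  show ?thesis unfolding pert_marginal_def
  proof (rule measure_eqI)
    fix A assume "A \<in> sets (distr (pert_dist d \<epsilon>) borel (vinner d u))"
    then have A [measurable]: "A \<in> sets borel" by simp
    let ?C = "vinner d u -` A \<inter> vecs d" and ?D = "(\<lambda>x. x 0) -` A \<inter> vecs d"
    have "emeasure ?L (?B \<inter> ?C) = emeasure (distr ?L ?L T) (?B \<inter> ?C)"
      by (simp add: T_distr)
    also have "\<dots> = emeasure ?L (T -` (?B \<inter> ?C) \<inter> vecs d)"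
      by (intro emeasure_distr) measurable
    also have "T -` (?B \<inter> ?C) \<inter> vecs d = ?B \<inter> ?D"
      using T(2,3) measurable_space[OF T_meas] by (auto simp: pert_ball_def)
    finally have "emeasure (pert_dist d \<epsilon>) ?C = emeasure (pert_dist d \<epsilon>) ?D"
      unfolding pert_dist_def by (subst (1 2) emeasure_uniform_measure) auto
    then show "emeasure (distr (pert_dist d \<epsilon>) borel (vinner d u)) A
        = emeasure (distr (pert_dist d \<epsilon>) borel (\<lambda>\<delta>. \<delta> 0)) A"
      by (subst (1 2) emeasure_distr) (auto simp: space_pert_dist measurable_cong_sets[OF sets_pert_dist refl])
  qed simp
qed

lemma real_distribution_pert_marginal:
  assumes "d \<ge> 1" "\<epsilon> > 0"
  shows "real_distribution (pert_marginal d \<epsilon>)"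
proof -
  interpret prob_space "pert_dist d \<epsilon>" using assms by (rule prob_space_pert_dist)
  have [measurable]: "(\<lambda>x. x 0) \<in> borel_measurable (lborel_vec d)"
    using assms by (intro measurable_lborel_vec_component) auto
  show ?thesis unfolding pert_marginal_def
    by (intro real_distribution_distr) measurable
qed

lemma emeasure_pert_marginal:
  assumes d: "d \<ge> 1" and A [measurable]: "A \<in> sets borel"
  shows "emeasure (pert_marginal d \<epsilon>) A
    = emeasure (lborel_vec d) {x \<in> pert_ball d \<epsilon>. x 0 \<in> A} / emeasure (lborel_vec d) (pert_ball d \<epsilon>)"
proof -
  have [measurable]: "(\<lambda>x. x 0) \<in> borel_measurable (lborel_vec d)"
    using assms by (intro measurable_lborel_vec_component) auto
  have "emeasure (pert_marginal d \<epsilon>) A = emeasure (pert_dist d \<epsilon>) ((\<lambda>x. x 0) -` A \<inter> vecs d)"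
    unfolding pert_marginal_def by (subst emeasure_distr) (auto simp: space_pert_dist)
  also have "\<dots> = emeasure (lborel_vec d) (pert_ball d \<epsilon> \<inter> ((\<lambda>x. x 0) -` A \<inter> vecs d)) / emeasure (lborel_vec d) (pert_ball d \<epsilon>)"
    unfolding pert_dist_def by (subst emeasure_uniform_measure) auto
  also have "pert_ball d \<epsilon> \<inter> ((\<lambda>x. x 0) -` A \<inter> vecs d) = {x \<in> pert_ball d \<epsilon>. x 0 \<in> A}"
    by (auto simp: pert_ball_def)
  finally show ?thesis .
qed

text \<open>A level set of coordinate 0 lies in a hyperplane, which is a null set. The absence of
  atoms makes the tail continuous and lets strict and weak inequalities be exchanged.\<close>

lemma measure_pert_marginal_singleton:
  assumes "d \<ge> 1"
  shows "measure (pert_marginal d \<epsilon>) {v} = 0"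
proof -
  have [measurable]: "(\<lambda>x. x 0) \<in> borel_measurable (lborel_vec d)"
    using assms by (intro measurable_lborel_vec_component) auto
  have "emeasure (lborel_vec d) {x \<in> pert_ball d \<epsilon>. x 0 \<in> {v}} \<le> emeasure (lborel_vec d) {x \<in> vecs d. x 0 = v}"
    by (intro emeasure_mono) (auto simp: pert_ball_def)
  then have "emeasure (lborel_vec d) {x \<in> pert_ball d \<epsilon>. x 0 \<in> {v}} = 0"
    using emeasure_lborel_vec_hyperplane[OF assms] by simp
  then show ?thesis
    using assms by (simp add: measure_def emeasure_pert_marginal)
qed

text \<open>Supplies the strict decrease of the tail, on which the uniqueness of
  \<open>cap_dist\<close> rests.\<close>

lemma measure_pert_marginal_interval_pos:
  assumes d: "d \<ge> 1" and \<epsilon>: "\<epsilon> > 0" and pq: "p < q" "- \<epsilon> < q" "q \<le> \<epsilon>"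
  shows "measure (pert_marginal d \<epsilon>) {p<..<q} > 0"
proof -
  interpret real_distribution "pert_marginal d \<epsilon>" using d \<epsilon> by (rule real_distribution_pert_marginal)
  have "emeasure (pert_marginal d \<epsilon>) {p<..<q} > 0"
    using emeasure_strip_pert_ball_pos[OF d pq] emeasure_pert_ball_finite[of d \<epsilon>] d
    by (simp add: emeasure_pert_marginal ennreal_zero_less_divide)
  then show ?thesis by (simp add: emeasure_eq_measure)
qed

text \<open>No point of the ball has coordinate 0 above \<epsilon>, and \<epsilon> itself is not an
  atom. This is the lower end of the intermediate value argument for
  \<open>cap_dist\<close>.\<close>

lemma measure_pert_marginal_beyond_radius:
  assumes d: "d \<ge> 1" and \<epsilon>: "\<epsilon> > 0"
  shows "measure (pert_marginal d \<epsilon>) {\<epsilon>..} = 0"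
proof -
  interpret real_distribution "pert_marginal d \<epsilon>" using d \<epsilon> by (rule real_distribution_pert_marginal)
  have "x 0 \<le> \<epsilon>" if "x \<in> pert_ball d \<epsilon>" for x
    using abs_component_le_vnorm[of 0 d x] that d unfolding pert_ball_def by auto
  then have empty: "{x \<in> pert_ball d \<epsilon>. x 0 \<in> {\<epsilon><..}} = {}" by force
  have "emeasure (pert_marginal d \<epsilon>) {\<epsilon><..} = emeasure (lborel_vec d) {x \<in> pert_ball d \<epsilon>. x 0 \<in> {\<epsilon><..}}
      / emeasure (lborel_vec d) (pert_ball d \<epsilon>)"
    using d by (rule emeasure_pert_marginal) simp
  then have "measure (pert_marginal d \<epsilon>) {\<epsilon><..} = 0" unfolding empty by (simp add: measure_def)
  moreover have "measure (pert_marginal d \<epsilon>) ({\<epsilon>} \<union> {\<epsilon><..})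
      = measure (pert_marginal d \<epsilon>) {\<epsilon>} + measure (pert_marginal d \<epsilon>) {\<epsilon><..}"
    by (intro finite_measure_Union) auto
  moreover have "{\<epsilon>} \<union> {\<epsilon><..} = {\<epsilon>..}" by auto
  ultimately show ?thesis using measure_pert_marginal_singleton[OF d] by simp
qed

text \<open>Rotation invariance applied to minus the first basis vector.\<close>

lemma distr_uminus_pert_marginal:
  assumes d: "d \<ge> 1"
  shows "distr (pert_marginal d \<epsilon>) borel uminus = pert_marginal d \<epsilon>"
proof -
  have [measurable]: "(\<lambda>x. x 0) \<in> borel_measurable (lborel_vec d)"
    using assms by (intro measurable_lborel_vec_component) auto
  define u where "u i = (if i = 0 then - 1 else 0 :: real)" for i :: nat
  have "(\<Sum>i<d. (u i)\<^sup>2) = (\<Sum>i<d. if i = 0 then 1 else 0)" by (intro sum.cong) (auto simp: u_def)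
  then have u: "vnorm d u = 1" using d by (simp add: L2_set_def)
  have "vinner d u x = (\<Sum>i<d. if i = 0 then - x 0 else 0)" for x
    unfolding vinner_def by (intro sum.cong) (auto simp: u_def)
  then have "vinner d u = (\<lambda>x. - x 0)" using d by (auto simp: fun_eq_iff)
  then have "pert_marginal d \<epsilon> = distr (pert_dist d \<epsilon>) borel (\<lambda>x. - x 0)"
    using distr_pert_dist_vinner[OF d u, of \<epsilon>] by simp
  also have "\<dots> = distr (pert_marginal d \<epsilon>) borel uminus"
    unfolding pert_marginal_def by (subst distr_distr) (auto simp: comp_def)
  finally show ?thesis ..
qed

lemma measure_pert_marginal_atMost:
  assumes d: "d \<ge> 1"
  shows "measure (pert_marginal d \<epsilon>) {..v} = measure (pert_marginal d \<epsilon>) {-v..}"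
proof -
  have "measure (pert_marginal d \<epsilon>) {-v..} = measure (distr (pert_marginal d \<epsilon>) borel uminus) {-v..}"
    by (simp add: distr_uminus_pert_marginal[OF d])
  also have "\<dots> = measure (pert_marginal d \<epsilon>) (uminus -` {-v..} \<inter> space (pert_marginal d \<epsilon>))"
    by (intro measure_distr) (auto simp: pert_marginal_def)
  also have "uminus -` {-v..} \<inter> space (pert_marginal d \<epsilon>) = {..v}"
    by (auto simp: pert_marginal_def)
  finally show ?thesis ..
qed

section \<open>The tail of the marginal and the cap distance\<close>

locale perturbation =
  fixes d :: nat and \<epsilon> :: real
  assumes d: "d \<ge> 1" and \<epsilon>: "\<epsilon> > 0"
begin

sublocale real_distribution "pert_marginal d \<epsilon>"
  using d \<epsilon> by (rule real_distribution_pert_marginal)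

abbreviation tail :: "real \<Rightarrow> real" where "tail s \<equiv> measure (pert_marginal d \<epsilon>) {s..}"

lemma tail_eq: "tail s = 1 - cdf (pert_marginal d \<epsilon>) s"
proof -
  have "prob (UNIV - {..s}) = 1 - prob {..s}"
    using prob_compl[of "{..s}"] by simp
  moreover have "tail s = prob {s} + prob {s<..}"
    by (subst finite_measure_Union[symmetric]) (auto intro: arg_cong[where f=prob])
  moreover have "UNIV - {..s} = {s<..}" by auto
  ultimately show ?thesis
    using measure_pert_marginal_singleton[OF d, of \<epsilon> s] by (simp add: cdf_def)
qed

lemma measure_greaterThan_eq_tail: "prob {s<..} = tail s"
proof -
  have "tail s = prob {s} + prob {s<..}"
    by (subst finite_measure_Union[symmetric]) (auto intro: arg_cong[where f=prob])
  then show ?thesis using measure_pert_marginal_singleton[OF d, of \<epsilon> s] by simp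
qed

lemma measure_atMost_eq_tail: "prob {..s} = tail (- s)"
  using d by (rule measure_pert_marginal_atMost)

lemma measure_lessThan_eq_tail: "prob {..<s} = tail (- s)"
proof -
  have "prob {..s} = prob {s} + prob {..<s}"
    by (subst finite_measure_Union[symmetric]) (auto intro: arg_cong[where f=prob])
  then show ?thesis using measure_pert_marginal_singleton[OF d, of \<epsilon> s] by (simp add: measure_atMost_eq_tail)
qed

lemma tail_antimono: "s \<le> t \<Longrightarrow> tail t \<le> tail s"
  by (intro finite_measure_mono) auto

lemma tail_strict_antimono:
  assumes "s < t" "- \<epsilon> < t" "t \<le> \<epsilon>"
  shows "tail t < tail s"
proof -
  have "0 < prob {s<..<t}"
    using d \<epsilon> assms by (rule measure_pert_marginal_interval_pos)
  moreover have "prob {s<..<t} + tail t = prob ({s<..<t} \<union> {t..})"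
    by (rule finite_measure_Union[symmetric]) auto
  moreover have "prob ({s<..<t} \<union> {t..}) \<le> tail s"
    using assms by (intro finite_measure_mono) (auto intro: less_imp_le)
  ultimately show ?thesis by linarith
qed

lemma tail_zero: "tail 0 = 1 / 2"
  using tail_eq[of 0] measure_atMost_eq_tail[of 0] by (simp add: cdf_def)

lemma tail_radius: "tail \<epsilon> = 0"
  using d \<epsilon> by (rule measure_pert_marginal_beyond_radius)

text \<open>Intermediate value theorem on \<open>{0..\<epsilon>}\<close>, where the tail falls from
  1/2 to 0; it is continuous because the marginal has no atoms.\<close>

lemma tail_attains:
  assumes "\<rho> \<in> {0..1/2}"
  obtains v where "0 \<le> v" "v \<le> \<epsilon>" "tail v = \<rho>"
proof -
  have "isCont tail x" for x
    unfolding tail_eq using isCont_cdf measure_pert_marginal_singleton[OF d, of \<epsilon> x]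
    by (intro continuous_intros) auto
  then have "\<exists>v\<ge>0. v \<le> \<epsilon> \<and> tail v = \<rho>"
    using assms \<epsilon> tail_zero tail_radius by (intro IVT2) auto
  then show ?thesis using that by blast
qed

text \<open>Since the right-hand side is free of \<open>u\<close>, the quantifier over unit vectors
  in \<open>cap_dist\<close> reduces to one equation for \<open>tail\<close>.\<close>

lemma cap_measure_eq_tail:
  assumes u: "vnorm d u = 1"
  shows "measure (pert_dist d \<epsilon>) {\<delta> \<in> pert_ball d \<epsilon>. vinner d u \<delta> \<ge> v} = tail v"
proof -
  have "tail v = measure (distr (pert_dist d \<epsilon>) borel (vinner d u)) {v..}"
    by (simp add: distr_pert_dist_vinner[OF d u])
  also have "\<dots> = measure (pert_dist d \<epsilon>) (vinner d u -` {v..} \<inter> vecs d)"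
    by (subst measure_distr) (auto simp: space_pert_dist)
  also have "\<dots> = measure (pert_dist d \<epsilon>) {\<delta> \<in> pert_ball d \<epsilon>. vinner d u \<delta> \<ge> v}"
  proof -
    have *: "{\<delta> \<in> pert_ball d \<epsilon>. vinner d u \<delta> \<ge> v} = pert_ball d \<epsilon> \<inter> (vinner d u -` {v..} \<inter> vecs d)"
      by (auto simp: pert_ball_def)
    have "pert_ball d \<epsilon> \<inter> (vinner d u -` {v..} \<inter> vecs d) \<in> sets (lborel_vec d)" by measurable
    then show ?thesis
      unfolding * measure_def pert_dist_def
      by (subst (1 2) emeasure_uniform_measure) (auto simp: Int_assoc[symmetric])
  qed
  finally show ?thesis ..
qed

text \<open>Existence comes from \<open>tail_attains\<close> and uniqueness from strict
  monotonicity, so the definite description in \<open>cap_dist\<close> denotes a number with the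
  defining properties.\<close>

lemma cap_dist_properties:
  assumes "\<rho> \<in> {0..1/2}"
  shows "0 \<le> cap_dist d \<epsilon> \<rho> \<and> cap_dist d \<epsilon> \<rho> \<le> \<epsilon> \<and> tail (cap_dist d \<epsilon> \<rho>) = \<rho>"
proof -
  \<comment> \<open>Some unit vector has to exist, since otherwise the condition on all
    \<open>u\<close> would hold vacuously; the restriction to \<open>{..<d}\<close> puts it into
    \<open>vecs d\<close>.\<close>
  define u where "u = (\<lambda>i\<in>{..<d}. if i = 0 then 1 else 0 :: real)"
  have "(\<Sum>i<d. (u i)\<^sup>2) = (\<Sum>i<d. if i = 0 then 1 else 0)" by (intro sum.cong) (auto simp: u_def)
  then have u: "vnorm d u = 1" "u \<in> vecs d"
    using d by (auto simp: L2_set_def space_lborel_vec u_def)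
  have eq: "(\<forall>u\<in>vecs d. vnorm d u = 1 \<longrightarrow>
      measure (pert_dist d \<epsilon>) {\<delta> \<in> pert_ball d \<epsilon>. vinner d u \<delta> \<ge> v} = \<rho>) \<longleftrightarrow> tail v = \<rho>" for v
    using u cap_measure_eq_tail by auto
  obtain v where v: "0 \<le> v" "v \<le> \<epsilon>" "tail v = \<rho>"
    using tail_attains[OF assms] by blast
  have "\<exists>!v. 0 \<le> v \<and> v \<le> \<epsilon> \<and> tail v = \<rho>"
  proof (rule ex1I[of _ v])
    fix w assume w: "0 \<le> w \<and> w \<le> \<epsilon> \<and> tail w = \<rho>"
    then show "w = v"
      using v \<epsilon> tail_strict_antimono[of v w] tail_strict_antimono[of w v]
      by (cases v w rule: linorder_cases) auto
  qed (use v in auto)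
  then show ?thesis unfolding cap_dist_def eq by (rule theI')
qed

text \<open>Turns the event inside the robust risk into a threshold on \<open>s\<close>. Strict
  decrease only asks that the right end point, here the cap distance, lie above
  \<open>- \<epsilon>\<close> and not above \<open>\<epsilon>\<close>, so arbitrarily small
  \<open>s\<close> are covered.\<close>

lemma less_tail_iff:
  assumes \<rho>: "\<rho> \<in> {0..1/2}"
  shows "\<rho> < tail s \<longleftrightarrow> s < cap_dist d \<epsilon> \<rho>"
  using cap_dist_properties[OF \<rho>] \<epsilon> tail_strict_antimono[of s "cap_dist d \<epsilon> \<rho>"]
    tail_antimono[of "cap_dist d \<epsilon> \<rho>" s]
  by (cases "s < cap_dist d \<epsilon> \<rho>") auto

text \<open>Chebyshev's inequality for the average over the coordinates, which all have the same law.\<close>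

lemma cap_dist_sq_le:
  assumes \<rho>: "\<rho> \<in> {0..1/2}"
  shows "real d * \<rho> * (cap_dist d \<epsilon> \<rho>)\<^sup>2 \<le> \<epsilon>\<^sup>2"
proof -
  define v where "v = cap_dist d \<epsilon> \<rho>"
  have v: "0 \<le> v" "tail v = \<rho>" using cap_dist_properties[OF \<rho>] by (auto simp: v_def)
  interpret P: prob_space "pert_dist d \<epsilon>" using d \<epsilon> by (rule prob_space_pert_dist)
  define C where "C i = {\<delta> \<in> pert_ball d \<epsilon>. v \<le> \<delta> i}" for i
  have C_sets [measurable]: "C i \<in> sets (pert_dist d \<epsilon>)" if "i < d" for i
  proof -
    have [measurable]: "(\<lambda>x. x i) \<in> borel_measurable (lborel_vec d)"
      using that by (rule measurable_lborel_vec_component)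
    have "{x \<in> space (lborel_vec d). x \<in> pert_ball d \<epsilon> \<and> v \<le> x i} \<in> sets (lborel_vec d)" by measurable
    also have "{x \<in> space (lborel_vec d). x \<in> pert_ball d \<epsilon> \<and> v \<le> x i} = C i"
      by (auto simp: C_def pert_ball_def)
    finally show ?thesis by (simp add: sets_pert_dist)
  qed
  \<comment> \<open>Rotation invariance for the \<open>i\<close>-th basis vector: the caps in all
    coordinate directions have the same mass.\<close>
  have C: "P.prob (C i) = \<rho>" if i: "i < d" for i
  proof -
    define u where "u j = (if j = i then 1 else 0 :: real)" for j
    have "(\<Sum>j<d. (u j)\<^sup>2) = (\<Sum>j<d. if j = i then 1 else 0)" by (intro sum.cong) (auto simp: u_def)
    then have u: "vnorm d u = 1" using i by (simp add: L2_set_def)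
    have "vinner d u x = (\<Sum>j<d. if j = i then x i else 0)" for x
      unfolding vinner_def by (intro sum.cong) (auto simp: u_def)
    then have "vinner d u x = x i" for x using i by simp
    then show ?thesis using cap_measure_eq_tail[OF u, of v] v(2) by (simp add: C_def)
  qed
  have C_int: "integrable (pert_dist d \<epsilon>) (indicat_real (C i))" if "i < d" for i
    using C_sets[OF that] by (simp add: integrable_real_indicator P.emeasure_eq_measure)
  have "real d * \<rho> * v\<^sup>2 = (\<Sum>i<d. P.prob (C i) * v\<^sup>2)" using C by simp
  also have "\<dots> = (\<Sum>i<d. P.expectation (\<lambda>x. indicator (C i) x * v\<^sup>2))"
    using C_sets by (intro sum.cong) auto
  also have "\<dots> = P.expectation (\<lambda>x. \<Sum>i<d. indicator (C i) x * v\<^sup>2)"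
    using C_int by (intro Bochner_Integration.integral_sum[symmetric]) auto
  also have "\<dots> \<le> P.expectation (\<lambda>x. \<epsilon>\<^sup>2)"
  proof (rule integral_mono)
    show "integrable (pert_dist d \<epsilon>) (\<lambda>x. \<Sum>i<d. indicator (C i) x * v\<^sup>2)"
      by (intro Bochner_Integration.integrable_sum integrable_mult_left) (auto intro: C_int)
    fix x
    \<comment> \<open>On the ball, a point of \<open>C i\<close> satisfies
      \<open>0 \<le> v \<le> x i\<close>; off the ball every indicator vanishes.\<close>
    have bound: "(indicator (C i) x * v\<^sup>2 :: real) \<le> (if x \<in> pert_ball d \<epsilon> then (x i)\<^sup>2 else 0)" for i
      using v(1) by (auto simp: C_def indicator_def intro!: power_mono)
    have "(\<Sum>i<d. indicator (C i) x * v\<^sup>2) \<le> (\<Sum>i<d. if x \<in> pert_ball d \<epsilon> then (x i)\<^sup>2 else 0)"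
      by (intro sum_mono bound)
    also have "\<dots> \<le> \<epsilon>\<^sup>2"
    proof (cases "x \<in> pert_ball d \<epsilon>")
      case True
      then have "(vnorm d x)\<^sup>2 \<le> \<epsilon>\<^sup>2" by (intro power_mono) (auto simp: pert_ball_def)
      then show ?thesis using True by (simp add: sq_vnorm)
    qed simp
    finally show "(\<Sum>i<d. indicator (C i) x * v\<^sup>2) \<le> \<epsilon>\<^sup>2" .
  qed auto
  also have "\<dots> = \<epsilon>\<^sup>2" by (simp add: P.prob_space)
  finally show ?thesis by (simp add: v_def)
qed

end

section \<open>Gaussian half-spaces\<close>

abbreviation Phi :: "real \<Rightarrow> real" where "Phi \<equiv> cdf std_normal_distribution"

interpretation std_normal: real_distribution std_normal_distribution
  by (rule real_dist_normal_dist)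

lemma measure_std_normal_singleton: "measure std_normal_distribution {t} = 0"
proof -
  have "AE x in lborel. x \<noteq> t" by (rule AE_lborel_singleton)
  then have "emeasure std_normal_distribution {t} = 0"
    by (subst emeasure_density) (auto intro!: nn_integral_zero' elim!: eventually_mono)
  then show ?thesis by (simp add: measure_def)
qed

lemma measure_std_normal_lessThan: "measure std_normal_distribution {..<t} = Phi t"
proof -
  have "Phi t = std_normal.prob {t} + std_normal.prob {..<t}"
    unfolding cdf_def
    by (subst std_normal.finite_measure_Union[symmetric]) (auto intro: arg_cong[where f="std_normal.prob"])
  then show ?thesis by (simp add: measure_std_normal_singleton)
qed

lemma Phi_mono: "s \<le> t \<Longrightarrow> Phi s \<le> Phi t"
  by (rule std_normal.cdf_nondecreasing)

text \<open>The substitution of \<open>- x\<close> for \<open>x\<close> leaves the even density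
  unchanged.\<close>

lemma measure_std_normal_atLeast: "measure std_normal_distribution {t..} = Phi (- t)"
proof -
  have "emeasure std_normal_distribution {t..} = (\<integral>\<^sup>+x. ennreal (std_normal_density x) * indicator {t..} x \<partial>lborel)"
    by (subst emeasure_density) auto
  also have "\<dots> = (\<integral>\<^sup>+x. ennreal (std_normal_density (0 + (-1) * x)) * indicator {t..} (0 + (-1) * x) \<partial>lborel)"
    by (subst nn_integral_real_affine[where c="-1" and t=0]) auto
  also have "\<dots> = (\<integral>\<^sup>+x. ennreal (std_normal_density x) * indicator {..-t} x \<partial>lborel)"
    by (intro nn_integral_cong) (auto simp: std_normal_density_def indicator_def)
  also have "\<dots> = emeasure std_normal_distribution {..-t}"
    by (subst emeasure_density) auto
  finally show ?thesis by (simp add: measure_def cdf_def)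
qed

lemma measure_std_normal_greaterThan: "measure std_normal_distribution {t<..} = Phi (- t)"
proof -
  have "std_normal.prob {t..} = std_normal.prob {t} + std_normal.prob {t<..}"
    by (subst std_normal.finite_measure_Union[symmetric]) (auto intro: arg_cong[where f="std_normal.prob"])
  then show ?thesis by (simp add: measure_std_normal_singleton measure_std_normal_atLeast)
qed

text \<open>The normal density is at most \<open>1 / sqrt (2 * pi)\<close>, hence at most 1; this
  crude constant is enough for the rate.\<close>

lemma Phi_lipschitz:
  assumes "s \<le> t"
  shows "Phi t - Phi s \<le> t - s"
proof (cases "s = t")
  case False
  have "emeasure std_normal_distribution {s<..t} = (\<integral>\<^sup>+x. ennreal (std_normal_density x) * indicator {s<..t} x \<partial>lborel)"
    by (subst emeasure_density) auto
  also have "\<dots> \<le> (\<integral>\<^sup>+x. indicator {s<..t} x \<partial>lborel)"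
  proof (intro nn_integral_mono)
    fix x :: real
    have "1 \<le> 2 * pi" using pi_ge_two by linarith
    then have "1 \<le> sqrt (2 * pi)" by simp
    then have "1 / sqrt (2 * pi) * exp (- x\<^sup>2 / 2) \<le> 1 * 1"
      by (intro mult_mono) auto
    then have "ennreal (std_normal_density x) \<le> ennreal 1"
      unfolding std_normal_density_def by (intro ennreal_leI) simp
    then show "ennreal (std_normal_density x) * indicator {s<..t} x \<le> indicator {s<..t} x"
      by (auto simp: indicator_def)
  qed
  also have "\<dots> = ennreal (t - s)" using assms by simp
  finally have "std_normal.prob {s<..t} \<le> t - s"
    using assms by (simp add: std_normal.emeasure_eq_measure)
  then show ?thesis using std_normal.cdf_diff_eq[of s t] assms False by simp
qed simp

section \<open>Linear functionals of a Gaussian vector\<close>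

lemma prob_space_gaussian_marginal: "prob_space (density lborel (normal_density m 1))"
  by (rule prob_space_normal_density) simp

lemma prob_space_gaussian_vec: "prob_space (gaussian_vec d m)"
  unfolding gaussian_vec_def by (intro prob_space_PiM prob_space_gaussian_marginal)

lemma sets_gaussian_vec [measurable_cong]: "sets (gaussian_vec d m) = sets (lborel_vec d)"
  unfolding gaussian_vec_def lborel_vec_def by (intro sets_PiM_cong) auto

lemma space_gaussian_vec: "space (gaussian_vec d m) = vecs d"
  by (rule sets_eq_imp_space_eq) (rule sets_gaussian_vec)

lemma distr_gaussian_vec_component:
  assumes "i < d"
  shows "distr (gaussian_vec d m) borel (\<lambda>x. x i) = density lborel (normal_density (m i) 1)"
proof -
  have "distr (gaussian_vec d m) borel (\<lambda>x. x i) = distr (gaussian_vec d m) (density lborel (normal_density (m i) 1)) (\<lambda>x. x i)"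
    by (intro distr_cong) auto
  also have "\<dots> = density lborel (normal_density (m i) 1)"
    unfolding gaussian_vec_def
    by (rule distr_PiM_component) (use assms prob_space_gaussian_marginal in auto)
  finally show ?thesis .
qed

text \<open>Independence is read off the joint law: collecting the coordinates into a vector is the
  identity on \<open>vecs d\<close>, so the joint law is the product measure itself. The criterion
  speaks of nonempty index sets, hence \<open>d \<ge> 1\<close>.\<close>

lemma indep_vars_gaussian_vec:
  assumes "d \<ge> 1"
  shows "prob_space.indep_vars (gaussian_vec d m) (\<lambda>_. borel) (\<lambda>i x. x i) {..<d}"
proof -
  interpret prob_space "gaussian_vec d m" by (rule prob_space_gaussian_vec)
  have rv: "(\<lambda>x. x i) \<in> borel_measurable (gaussian_vec d m)" if "i < d" for i
    using measurable_lborel_vec_component[OF that] by (simp add: measurable_cong_sets[OF sets_gaussian_vec refl])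
  have "distr (gaussian_vec d m) (Pi\<^sub>M {..<d} (\<lambda>_. borel)) (\<lambda>x. \<lambda>i\<in>{..<d}. x i) = distr (gaussian_vec d m) (gaussian_vec d m) (\<lambda>x. x)"
    by (intro distr_cong) (auto simp: sets_gaussian_vec sets_lborel_vec space_gaussian_vec space_lborel_vec)
  also have "\<dots> = gaussian_vec d m" by (rule distr_id2) simp
  also have "\<dots> = (\<Pi>\<^sub>M i\<in>{..<d}. distr (gaussian_vec d m) borel (\<lambda>x. x i))"
    unfolding gaussian_vec_def
    by (intro PiM_cong refl) (auto simp: distr_gaussian_vec_component[unfolded gaussian_vec_def])
  finally show ?thesis
    using assms rv by (subst indep_vars_iff_distr_eq_PiM') (auto simp: lessThan_empty_iff)
qed

text \<open>\<open>vinner d w\<close> is a sum of independent normal variables with means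
  \<open>w i * m i\<close> and standard deviations \<open>\<bar>w i\<bar>\<close>, hence normal with
  mean \<open>vinner d w m\<close> and standard deviation \<open>vnorm d w\<close>.\<close>

lemma distr_gaussian_vec_vinner:
  assumes w: "vnorm d w > 0"
  shows "distr (gaussian_vec d m) borel (\<lambda>x. (vinner d w x - vinner d w m) / vnorm d w) = std_normal_distribution"
proof -
  let ?G = "gaussian_vec d m"
  interpret prob_space ?G by (rule prob_space_gaussian_vec)
  \<comment> \<open>Coordinates of weight 0 are dropped because \<open>sum_indep_normal\<close> asks
    for positive standard deviations; the sums stay the same.\<close>
  define I where "I = {i. i < d \<and> w i \<noteq> 0}"
  have I: "finite I" "I \<subseteq> {..<d}" by (auto simp: I_def)
  have sum_I: "(\<Sum>i\<in>I. f i) = (\<Sum>i<d. f i)" if "\<And>i. w i = 0 \<Longrightarrow> f i = 0" for f :: "nat \<Rightarrow> real"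
    using that by (intro sum.mono_neutral_left) (auto simp: I_def)
  have "I \<noteq> {}"
  proof
    assume "I = {}"
    then have "w i = 0" if "i < d" for i using that by (auto simp: I_def)
    then show False using w by (simp add: L2_set_def)
  qed
  then have d: "d \<ge> 1" using I by force
  have rv [measurable]: "(\<lambda>x. x i) \<in> borel_measurable ?G" if "i < d" for i
    using measurable_lborel_vec_component[OF that] by (simp add: measurable_cong_sets[OF sets_gaussian_vec refl])
  have distr_i: "distributed ?G lborel (\<lambda>x. x i) (normal_density (m i) 1)" if "i < d" for i
  proof -
    have "distr ?G lborel (\<lambda>x. x i) = distr ?G borel (\<lambda>x. x i)" by (intro distr_cong) auto
    then show ?thesis
      using rv[OF that] by (simp add: distributed_def distr_gaussian_vec_component[OF that])
  qed
  have "distributed ?G lborel (\<lambda>x. w i * x i) (normal_density (w i * m i) \<bar>w i\<bar>)" if "i \<in> I" for i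
    using normal_density_affine[OF distr_i[of i], of "w i" 0] that by (simp add: I_def)
  moreover have "indep_vars (\<lambda>_. borel) (\<lambda>i x. w i * x i) I"
    using indep_vars_compose2[OF indep_vars_subset[OF indep_vars_gaussian_vec[OF d] I(2)], of "\<lambda>i y. w i * y" "\<lambda>_. borel"]
    by simp
  ultimately have "distributed ?G lborel (\<lambda>x. \<Sum>i\<in>I. w i * x i)
      (normal_density (\<Sum>i\<in>I. w i * m i) (sqrt (\<Sum>i\<in>I. \<bar>w i\<bar>\<^sup>2)))"
    using I(1) \<open>I \<noteq> {}\<close> by (intro sum_indep_normal) (auto simp: I_def)
  then have "distributed ?G lborel (vinner d w) (normal_density (vinner d w m) (vnorm d w))"
    unfolding vinner_def[abs_def] L2_set_def by (simp add: sum_I)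
  then have "distributed ?G lborel (\<lambda>x. (vinner d w x - vinner d w m) / vnorm d w) std_normal_density"
    by (simp only: normal_standard_normal_convert[OF w])
  then have "distr ?G lborel (\<lambda>x. (vinner d w x - vinner d w m) / vnorm d w) = std_normal_distribution"
    by (simp add: distributed_def)
  moreover have "distr ?G lborel f = distr ?G borel f" for f :: "_ \<Rightarrow> real"
    by (intro distr_cong) auto
  ultimately show ?thesis by simp
qed

lemma measure_gaussian_vec_vinner:
  assumes w: "vnorm d w > 0" and A: "A \<in> sets borel"
  shows "measure (gaussian_vec d m) {x \<in> vecs d. (vinner d w x - vinner d w m) / vnorm d w \<in> A} = measure std_normal_distribution A"
proof -
  have "measure std_normal_distribution A
      = measure (distr (gaussian_vec d m) borel (\<lambda>x. (vinner d w x - vinner d w m) / vnorm d w)) A"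
    by (simp add: distr_gaussian_vec_vinner[OF w])
  also have "\<dots> = measure (gaussian_vec d m) ((\<lambda>x. (vinner d w x - vinner d w m) / vnorm d w) -` A \<inter> vecs d)"
    using A by (subst measure_distr) (auto simp: space_gaussian_vec)
  also have "(\<lambda>x. (vinner d w x - vinner d w m) / vnorm d w) -` A \<inter> vecs d
      = {x \<in> vecs d. (vinner d w x - vinner d w m) / vnorm d w \<in> A}" by auto
  finally show ?thesis ..
qed

text \<open>All four kinds occur as error sets: the label selects the side, and the value of the
  sign at 0 decides whether the boundary belongs to the set. The boundary has mass 0.\<close>

lemma gaussian_vec_halfspaces:
  assumes w: "vnorm d w > 0"
  shows "measure (gaussian_vec d m) {x \<in> vecs d. vinner d w x \<le> c} = Phi ((c - vinner d w m) / vnorm d w)"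
    and "measure (gaussian_vec d m) {x \<in> vecs d. vinner d w x < c} = Phi ((c - vinner d w m) / vnorm d w)"
    and "measure (gaussian_vec d m) {x \<in> vecs d. c \<le> vinner d w x} = Phi ((vinner d w m - c) / vnorm d w)"
    and "measure (gaussian_vec d m) {x \<in> vecs d. c < vinner d w x} = Phi ((vinner d w m - c) / vnorm d w)"
proof -
  define t where "t = (c - vinner d w m) / vnorm d w"
  have t: "- t = (vinner d w m - c) / vnorm d w" by (simp add: t_def minus_divide_left)
  have "{x \<in> vecs d. vinner d w x \<le> c} = {x \<in> vecs d. (vinner d w x - vinner d w m) / vnorm d w \<in> {..t}}"
    "{x \<in> vecs d. vinner d w x < c} = {x \<in> vecs d. (vinner d w x - vinner d w m) / vnorm d w \<in> {..<t}}"
    "{x \<in> vecs d. c \<le> vinner d w x} = {x \<in> vecs d. (vinner d w x - vinner d w m) / vnorm d w \<in> {t..}}"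
    "{x \<in> vecs d. c < vinner d w x} = {x \<in> vecs d. (vinner d w x - vinner d w m) / vnorm d w \<in> {t<..}}"
    using w by (auto simp: t_def divide_le_cancel divide_less_cancel)
  then show "measure (gaussian_vec d m) {x \<in> vecs d. vinner d w x \<le> c} = Phi ((c - vinner d w m) / vnorm d w)"
    "measure (gaussian_vec d m) {x \<in> vecs d. vinner d w x < c} = Phi ((c - vinner d w m) / vnorm d w)"
    "measure (gaussian_vec d m) {x \<in> vecs d. c \<le> vinner d w x} = Phi ((vinner d w m - c) / vnorm d w)"
    "measure (gaussian_vec d m) {x \<in> vecs d. c < vinner d w x} = Phi ((vinner d w m - c) / vnorm d w)"
    unfolding t_def[symmetric] t[symmetric]
    by (simp_all only: measure_gaussian_vec_vinner[OF w] borel_closed borel_open closed_atMost closed_atLeast open_lessThan open_greaterThan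
        measure_std_normal_lessThan measure_std_normal_atLeast measure_std_normal_greaterThan cdf_def)
qed

section \<open>Bayes optimality\<close>

lemma space_data_dist: "space (data_dist d \<pi> \<mu>) = vecs d \<times> UNIV"
  and sets_data_dist: "sets (data_dist d \<pi> \<mu>) = sets (lborel_vec d \<Otimes>\<^sub>M count_space UNIV)"
proof -
  show sets: "sets (data_dist d \<pi> \<mu>) = sets (lborel_vec d \<Otimes>\<^sub>M count_space UNIV)"
    unfolding data_dist_def by (rule sets_bind) auto
  show "space (data_dist d \<pi> \<mu>) = vecs d \<times> UNIV"
    using sets_eq_imp_space_eq[OF sets] by (simp add: space_pair_measure)
qed

lemma measurable_data_point: "(\<lambda>x. (x, y)) \<in> gaussian_vec d m \<rightarrow>\<^sub>M (lborel_vec d \<Otimes>\<^sub>M count_space UNIV)"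
  by measurable

text \<open>Integrating over the two-point law of the label makes the data distribution a mixture of
  two Gaussian laws.\<close>

lemma emeasure_data_dist:
  assumes \<pi>: "0 < \<pi>" "\<pi> < 1" and X: "X \<in> sets (lborel_vec d \<Otimes>\<^sub>M count_space UNIV)"
  shows "emeasure (data_dist d \<pi> \<mu>) X =
    ennreal \<pi> * emeasure (gaussian_vec d (vscale d 1 \<mu>)) {x \<in> vecs d. (x, 1) \<in> X}
    + ennreal (1 - \<pi>) * emeasure (gaussian_vec d (vscale d (-1) \<mu>)) {x \<in> vecs d. (x, -1) \<in> X}"
proof -
  let ?N = "lborel_vec d \<Otimes>\<^sub>M count_space (UNIV :: int set)"
  let ?G = "\<lambda>y. gaussian_vec d (vscale d (of_int y) \<mu>)"
  let ?K = "\<lambda>y. distr (?G y) ?N (\<lambda>x. (x, y))"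
  have "?K y \<in> space (subprob_algebra ?N)" for y
  proof -
    interpret prob_space "?G y" by (rule prob_space_gaussian_vec)
    interpret D: prob_space "?K y" by (rule prob_space_distr) (rule measurable_data_point)
    show ?thesis by (simp add: space_subprob_algebra D.subprob_space_axioms)
  qed
  then have K: "?K \<in> measure_pmf (label_pmf \<pi>) \<rightarrow>\<^sub>M subprob_algebra ?N" by simp
  have K_X: "emeasure (?K y) X = emeasure (?G y) {x \<in> vecs d. (x, y) \<in> X}" for y
  proof -
    have "(\<lambda>x. (x, y)) -` X \<inter> vecs d = {x \<in> vecs d. (x, y) \<in> X}" by auto
    then show ?thesis using X measurable_data_point by (subst emeasure_distr) (auto simp: space_gaussian_vec)
  qed
  have "emeasure (data_dist d \<pi> \<mu>) X = (\<integral>\<^sup>+y. emeasure (?K y) X \<partial>label_pmf \<pi>)"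
    unfolding data_dist_def by (rule emeasure_bind[OF _ K X]) simp
  also have "\<dots> = ennreal \<pi> * emeasure (?K 1) X + ennreal (1 - \<pi>) * emeasure (?K (-1)) X"
    unfolding label_pmf_def using \<pi> by (simp add: mult.commute)
  finally show ?thesis unfolding K_X by simp
qed

lemma measure_data_dist:
  assumes \<pi>: "0 < \<pi>" "\<pi> < 1" and P: "\<And>y. {x \<in> vecs d. P x y} \<in> sets (lborel_vec d)"
  shows "{(x, y) \<in> space (data_dist d \<pi> \<mu>). P x y} \<in> sets (data_dist d \<pi> \<mu>)"
    and "measure (data_dist d \<pi> \<mu>) {(x, y) \<in> space (data_dist d \<pi> \<mu>). P x y} =
      \<pi> * measure (gaussian_vec d (vscale d 1 \<mu>)) {x \<in> vecs d. P x 1}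
      + (1 - \<pi>) * measure (gaussian_vec d (vscale d (-1) \<mu>)) {x \<in> vecs d. P x (-1)}"
proof -
  let ?X = "{(x, y) \<in> space (data_dist d \<pi> \<mu>). P x y}"
  interpret P: prob_space "gaussian_vec d (vscale d 1 \<mu>)" by (rule prob_space_gaussian_vec)
  interpret N: prob_space "gaussian_vec d (vscale d (-1) \<mu>)" by (rule prob_space_gaussian_vec)
  \<comment> \<open>Labels are integers, so the set is a countable union of measurable
    slices.\<close>
  have "?X = (\<Union>y. {x \<in> vecs d. P x y} \<times> {y})" by (auto simp: space_data_dist)
  also have "\<dots> \<in> sets (lborel_vec d \<Otimes>\<^sub>M count_space UNIV)"
    using P by (intro sets.countable_UN'') auto
  finally have X: "?X \<in> sets (lborel_vec d \<Otimes>\<^sub>M count_space UNIV)" .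
  then show "?X \<in> sets (data_dist d \<pi> \<mu>)" by (simp add: sets_data_dist)
  have "emeasure (data_dist d \<pi> \<mu>) ?X =
    ennreal (\<pi> * P.prob {x \<in> vecs d. P x 1} + (1 - \<pi>) * N.prob {x \<in> vecs d. P x (-1)})"
    using \<pi> by (subst emeasure_data_dist[OF \<pi> X])
      (simp add: space_data_dist P.emeasure_eq_measure N.emeasure_eq_measure ennreal_mult' ennreal_plus)
  then show "measure (data_dist d \<pi> \<mu>) ?X =
      \<pi> * P.prob {x \<in> vecs d. P x 1} + (1 - \<pi>) * N.prob {x \<in> vecs d. P x (-1)}"
    using \<pi> by (intro measure_eq_emeasure_eq_ennreal) auto
qed

lemma SR_eq:
  assumes \<pi>: "0 < \<pi>" "\<pi> < 1" and h: "\<And>y. {x \<in> vecs d. h x \<noteq> y} \<in> sets (lborel_vec d)"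
  shows "SR d \<pi> \<mu> h = \<pi> * measure (gaussian_vec d (vscale d 1 \<mu>)) {x \<in> vecs d. h x \<noteq> 1}
      + (1 - \<pi>) * measure (gaussian_vec d (vscale d (-1) \<mu>)) {x \<in> vecs d. h x \<noteq> -1}"
  unfolding SR_def by (rule measure_data_dist(2)[OF \<pi>]) (rule h)

lemma PR_eq:
  assumes \<pi>: "0 < \<pi>" "\<pi> < 1"
    and P: "\<And>y. {x \<in> vecs d. \<rho> < measure (pert_dist d \<epsilon>) {\<delta> \<in> vecs d. h (vadd d x \<delta>) \<noteq> y}} \<in> sets (lborel_vec d)"
  shows "PR d \<pi> \<epsilon> \<mu> h \<rho> =
      \<pi> * measure (gaussian_vec d (vscale d 1 \<mu>))
        {x \<in> vecs d. \<rho> < measure (pert_dist d \<epsilon>) {\<delta> \<in> vecs d. h (vadd d x \<delta>) \<noteq> 1}}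
      + (1 - \<pi>) * measure (gaussian_vec d (vscale d (-1) \<mu>))
        {x \<in> vecs d. \<rho> < measure (pert_dist d \<epsilon>) {\<delta> \<in> vecs d. h (vadd d x \<delta>) \<noteq> -1}}"
proof -
  let ?P = "\<lambda>x y. \<rho> < measure (pert_dist d \<epsilon>) {\<delta> \<in> vecs d. h (vadd d x \<delta>) \<noteq> y}"
  let ?X = "{(x, y) \<in> space (data_dist d \<pi> \<mu>). ?P x y}"
  have "PR d \<pi> \<epsilon> \<mu> h \<rho> = (\<integral>p. indicator ?X p \<partial>data_dist d \<pi> \<mu>)"
    unfolding PR_def by (intro Bochner_Integration.integral_cong) auto
  also have "\<dots> = measure (data_dist d \<pi> \<mu>) (?X \<inter> space (data_dist d \<pi> \<mu>))"
    by (rule Bochner_Integration.integral_indicator)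
  also have "?X \<inter> space (data_dist d \<pi> \<mu>) = ?X" by auto
  finally show ?thesis using measure_data_dist(2)[OF \<pi>, of d ?P \<mu>] P by simp
qed

section \<open>Gaussian likelihoods and the Bayes rule\<close>

lemma gaussian_vec_eq_density:
  "gaussian_vec d m = density (lborel_vec d) (\<lambda>x. \<Prod>i<d. ennreal (normal_density (m i) 1 (x i)))"
proof -
  let ?f = "\<lambda>x. \<Prod>i<d. ennreal (normal_density (m i) 1 (x i))"
  interpret product_sigma_finite "\<lambda>i. density lborel (normal_density (m i) 1)"
    by (intro product_sigma_finite.intro prob_space_imp_sigma_finite prob_space_gaussian_marginal)
  have f: "?f \<in> borel_measurable (lborel_vec d)"
  proof (intro borel_measurable_prod_ennreal)
    fix i assume "i \<in> {..<d}"
    then have [measurable]: "(\<lambda>x. x i) \<in> borel_measurable (lborel_vec d)"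
      by (intro measurable_lborel_vec_component) simp
    show "(\<lambda>x. ennreal (normal_density (m i) 1 (x i))) \<in> borel_measurable (lborel_vec d)" by measurable
  qed
  show ?thesis unfolding gaussian_vec_def
  \<comment> \<open>A product measure is determined by its values on boxes, and over a box the
    integral of the product density factorises.\<close>
  proof (rule PiM_eqI[symmetric])
    show "sets (density (lborel_vec d) ?f) = sets (\<Pi>\<^sub>M i\<in>{..<d}. density lborel (\<lambda>x. ennreal (normal_density (m i) 1 x)))"
      unfolding sets_density lborel_vec_def by (intro sets_PiM_cong) auto
    fix A assume "\<And>i. i \<in> {..<d} \<Longrightarrow> A i \<in> sets (density lborel (\<lambda>x. ennreal (normal_density (m i) 1 x)))"
    then have A: "A i \<in> sets borel" if "i < d" for i using that by auto
    have box: "Pi\<^sub>E {..<d} A \<in> sets (lborel_vec d)"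
      unfolding lborel_vec_def using A by (intro sets_PiM_I_finite) auto
    have "emeasure (density (lborel_vec d) ?f) (Pi\<^sub>E {..<d} A) = (\<integral>\<^sup>+x. ?f x * indicator (Pi\<^sub>E {..<d} A) x \<partial>lborel_vec d)"
      using f box by (rule emeasure_density)
    also have "\<dots> = (\<integral>\<^sup>+x. (\<Prod>i<d. ennreal (normal_density (m i) 1 (x i)) * indicator (A i) (x i)) \<partial>lborel_vec d)"
    proof (rule nn_integral_cong)
      fix x assume "x \<in> vecs d"
      then have "indicator (Pi\<^sub>E {..<d} A) x = (\<Prod>i<d. indicator (A i) (x i) :: ennreal)"
        by (auto simp: indicator_def space_lborel_vec PiE_iff prod_zero_iff)
      then show "?f x * indicator (Pi\<^sub>E {..<d} A) x = (\<Prod>i<d. ennreal (normal_density (m i) 1 (x i)) * indicator (A i) (x i))"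
        by (simp add: prod.distrib)
    qed
    also have "\<dots> = (\<Prod>i<d. \<integral>\<^sup>+y. ennreal (normal_density (m i) 1 y) * indicator (A i) y \<partial>lborel)"
      unfolding lborel_vec_def using A
      by (intro lebesgue_product.product_nn_integral_prod) auto
    also have "\<dots> = (\<Prod>i<d. emeasure (density lborel (\<lambda>x. ennreal (normal_density (m i) 1 x))) (A i))"
      using A by (intro prod.cong) (auto simp: emeasure_density)
    finally show "emeasure (density (lborel_vec d) ?f) (Pi\<^sub>E {..<d} A) = \<dots>" .
  qed simp
qed

definition gaussian_density :: "nat \<Rightarrow> (nat \<Rightarrow> real) \<Rightarrow> (nat \<Rightarrow> real) \<Rightarrow> real" where
  "gaussian_density d m x = (\<Prod>i<d. normal_density (m i) 1 (x i))"

lemma gaussian_density_nonneg: "0 \<le> gaussian_density d m x"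
  unfolding gaussian_density_def by (intro prod_nonneg) auto

lemma measurable_gaussian_density [measurable]: "gaussian_density d m \<in> borel_measurable (lborel_vec d)"
  unfolding gaussian_density_def[abs_def]
proof (intro borel_measurable_prod)
  fix i assume "i \<in> {..<d}"
  then have [measurable]: "(\<lambda>x. x i) \<in> borel_measurable (lborel_vec d)"
    by (intro measurable_lborel_vec_component) simp
  show "(\<lambda>x. normal_density (m i) 1 (x i)) \<in> borel_measurable (lborel_vec d)" by measurable
qed

lemma emeasure_gaussian_vec:
  assumes "A \<in> sets (lborel_vec d)"
  shows "emeasure (gaussian_vec d m) A = (\<integral>\<^sup>+x. ennreal (gaussian_density d m x) * indicator A x \<partial>lborel_vec d)"
proof -
  have "gaussian_vec d m = density (lborel_vec d) (\<lambda>x. ennreal (gaussian_density d m x))"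
    unfolding gaussian_vec_eq_density gaussian_density_def by (simp add: prod_ennreal)
  then show ?thesis using assms by (simp add: emeasure_density)
qed

text \<open>Expanding the squares in the exponents. Only the last factor sees the sign of
  \<open>a\<close>, so the likelihoods for \<open>a = 1\<close> and \<open>a = -1\<close> share the
  other two.\<close>

lemma gaussian_density_vscale:
  "gaussian_density d (vscale d a \<mu>) x
     = gaussian_density d (\<lambda>_. 0) x * exp (- a\<^sup>2 * vinner d \<mu> \<mu> / 2) * exp (a * vinner d \<mu> x)"
proof -
  have "normal_density (a * \<mu> i) 1 (x i)
      = normal_density 0 1 (x i) * exp (- a\<^sup>2 * (\<mu> i * \<mu> i) / 2) * exp (a * (\<mu> i * x i))" for i
    by (simp add: normal_density_def exp_add[symmetric] power2_eq_square field_simps)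
  then have "gaussian_density d (vscale d a \<mu>) x
      = (\<Prod>i<d. normal_density 0 1 (x i) * exp (- a\<^sup>2 * (\<mu> i * \<mu> i) / 2) * exp (a * (\<mu> i * x i)))"
    unfolding gaussian_density_def by (intro prod.cong) (auto simp: vscale_def)
  also have "\<dots> = gaussian_density d (\<lambda>_. 0) x * exp (\<Sum>i<d. - a\<^sup>2 * (\<mu> i * \<mu> i) / 2) * exp (\<Sum>i<d. a * (\<mu> i * x i))"
    by (simp add: prod.distrib exp_sum gaussian_density_def)
  finally show ?thesis by (simp add: vinner_def sum_distrib_left sum_divide_distrib)
qed

text \<open>Both labels are brought under one integral so that risks can be compared pointwise; in
  \<open>ennreal\<close> this comparison raises no question of integrability.\<close>

lemma ennreal_SR_eq:
  assumes \<pi>: "0 < \<pi>" "\<pi> < 1" and h: "\<And>y. {x \<in> vecs d. h x \<noteq> y} \<in> sets (lborel_vec d)"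
  shows "ennreal (SR d \<pi> \<mu> h) = (\<integral>\<^sup>+x. ennreal (\<pi> * gaussian_density d (vscale d 1 \<mu>) x) * of_bool (h x \<noteq> 1)
     + ennreal ((1 - \<pi>) * gaussian_density d (vscale d (-1) \<mu>) x) * of_bool (h x \<noteq> -1) \<partial>lborel_vec d)"
proof -
  let ?f = "\<lambda>a. gaussian_density d (vscale d a \<mu>)"
  interpret P: prob_space "gaussian_vec d (vscale d 1 \<mu>)" by (rule prob_space_gaussian_vec)
  interpret N: prob_space "gaussian_vec d (vscale d (-1) \<mu>)" by (rule prob_space_gaussian_vec)
  define H where "H y = {x \<in> vecs d. h x \<noteq> y}" for y
  have [measurable]: "H y \<in> sets (lborel_vec d)" for y unfolding H_def by (rule h)
  have "ennreal (SR d \<pi> \<mu> h) = ennreal \<pi> * emeasure (gaussian_vec d (vscale d 1 \<mu>)) (H 1)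
     + ennreal (1 - \<pi>) * emeasure (gaussian_vec d (vscale d (-1) \<mu>)) (H (-1))"
    using \<pi> by (simp add: SR_eq[OF \<pi> h] H_def P.emeasure_eq_measure N.emeasure_eq_measure ennreal_mult' ennreal_plus)
  also have "\<dots> = (\<integral>\<^sup>+x. ennreal \<pi> * (ennreal (?f 1 x) * indicator (H 1) x)
     + ennreal (1 - \<pi>) * (ennreal (?f (-1) x) * indicator (H (-1)) x) \<partial>lborel_vec d)"
    by (simp add: emeasure_gaussian_vec nn_integral_add nn_integral_cmult)
  also have "\<dots> = (\<integral>\<^sup>+x. ennreal (\<pi> * ?f 1 x) * of_bool (h x \<noteq> 1)
     + ennreal ((1 - \<pi>) * ?f (-1) x) * of_bool (h x \<noteq> -1) \<partial>lborel_vec d)"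
    using \<pi> by (intro nn_integral_cong) (auto simp: H_def indicator_def ennreal_mult gaussian_density_nonneg)
  finally show ?thesis .
qed

lemma measurable_sign [measurable]:
  assumes "s\<^sub>0 \<in> {-1, 1}"
  shows "sign s\<^sub>0 \<in> borel \<rightarrow>\<^sub>M count_space {-1, 1}"
proof -
  have "{z \<in> space borel. (0::real) < z} \<in> sets borel" "{z \<in> space borel. z < (0::real)} \<in> sets borel"
    by measurable
  then show ?thesis
    unfolding sign_def[abs_def] using assms by (intro measurable_If) auto
qed

lemma linear_classifier_measurable:
  assumes "s\<^sub>0 \<in> {-1, 1}"
  shows "(\<lambda>x. sign s\<^sub>0 (vinner d w x - c)) \<in> lborel_vec d \<rightarrow>\<^sub>M count_space {-1, 1}"
  using measurable_sign[OF assms] by measurable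

lemma classifier_error_sets:
  assumes "h \<in> lborel_vec d \<rightarrow>\<^sub>M count_space {-1, 1}"
  shows "{x \<in> vecs d. h x \<noteq> (y :: int)} \<in> sets (lborel_vec d)"
proof -
  have "{x \<in> vecs d. h x \<noteq> y} = h -` ({-1, 1} - {y}) \<inter> vecs d"
    using measurable_space[OF assms] by auto
  also have "\<dots> \<in> sets (lborel_vec d)"
    using assms by (rule measurable_sets) auto
  finally show ?thesis .
qed

lemma SR_nonneg: "0 \<le> SR d \<pi> \<mu> h"
  by (simp add: SR_def)

lemma h_Bayes_measurable:
  assumes "s\<^sub>0 \<in> {-1, 1}"
  shows "h_Bayes s\<^sub>0 d \<pi> \<mu> \<in> lborel_vec d \<rightarrow>\<^sub>M count_space {-1, 1}"
  using linear_classifier_measurable[OF assms, of d \<mu> "log_odds \<pi> / 2"]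
  by (simp add: h_Bayes_def[abs_def] vinner_commute)

text \<open>At each \<open>x\<close> the integrand of the risk is the weighted likelihood of the
  label that is not predicted, and the Bayes rule predicts a label of largest weighted
  likelihood.\<close>

lemma SR_h_Bayes_le:
  assumes \<pi>: "0 < \<pi>" "\<pi> < 1" and s0: "s\<^sub>0 \<in> {-1, 1}" and h: "h \<in> lborel_vec d \<rightarrow>\<^sub>M count_space {-1, 1}"
  shows "SR d \<pi> \<mu> (h_Bayes s\<^sub>0 d \<pi> \<mu>) \<le> SR d \<pi> \<mu> h"
proof -
  let ?b = "h_Bayes s\<^sub>0 d \<pi> \<mu>"
  let ?f = "\<lambda>a. gaussian_density d (vscale d a \<mu>)"
  have "ennreal (SR d \<pi> \<mu> ?b) \<le> ennreal (SR d \<pi> \<mu> h)"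
    unfolding ennreal_SR_eq[OF \<pi> classifier_error_sets[OF h]]
      ennreal_SR_eq[OF \<pi> classifier_error_sets[OF h_Bayes_measurable[OF s0]]]
  proof (rule nn_integral_mono)
    fix x assume x: "x \<in> vecs d"
    define t where "t = vinner d \<mu> x"
    define K where "K = gaussian_density d (\<lambda>_. 0) x * exp (- vinner d \<mu> \<mu> / 2)"
    have K: "0 \<le> K" by (simp add: K_def gaussian_density_nonneg)
    have f: "?f 1 x = K * exp t" "?f (-1) x = K * exp (- t)"
      by (simp_all add: gaussian_density_vscale K_def t_def)
    have odds: "\<pi> * exp (log_odds \<pi>) = 1 - \<pi>" using \<pi> by (simp add: log_odds_def)
    \<comment> \<open>Extracts \<open>exp (- t)\<close> from both weighted likelihoods, which leaves
      \<open>\<pi> * exp (2 * t)\<close> to be compared with \<open>1 - \<pi>\<close>.\<close>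
    have fac: "\<pi> * exp t = \<pi> * exp (2 * t) * exp (- t)" by (simp add: exp_add[symmetric])
    have pos: "(1 - \<pi>) * ?f (-1) x \<le> \<pi> * ?f 1 x" if "log_odds \<pi> \<le> 2 * t"
    proof -
      have "1 - \<pi> \<le> \<pi> * exp (2 * t)" using that \<pi> unfolding odds[symmetric] by simp
      then have "(1 - \<pi>) * exp (- t) \<le> \<pi> * exp t" unfolding fac by (rule mult_right_mono) simp
      from mult_left_mono[OF this K] show ?thesis by (simp add: f mult_ac)
    qed
    have neg: "\<pi> * ?f 1 x \<le> (1 - \<pi>) * ?f (-1) x" if "2 * t \<le> log_odds \<pi>"
    proof -
      have "\<pi> * exp (2 * t) \<le> 1 - \<pi>" using that \<pi> unfolding odds[symmetric] by simp
      then have "\<pi> * exp t \<le> (1 - \<pi>) * exp (- t)" unfolding fac by (rule mult_right_mono) simp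
      from mult_left_mono[OF this K] show ?thesis by (simp add: f mult_ac)
    qed
    \<comment> \<open>The inequalities are weak to include the boundary, where both weighted
      likelihoods agree and either value of \<open>s\<^sub>0\<close> is optimal.\<close>
    have "?b x = 1 \<Longrightarrow> log_odds \<pi> \<le> 2 * t" "?b x = - 1 \<Longrightarrow> 2 * t \<le> log_odds \<pi>"
      by (auto simp: h_Bayes_def sign_def t_def vinner_commute[of d x] split: if_splits)
    moreover have "?b x \<in> {-1, 1}" "h x \<in> {-1, 1}"
      using measurable_space[OF h_Bayes_measurable[OF s0] x] measurable_space[OF h x] by auto
    ultimately show "ennreal (\<pi> * ?f 1 x) * of_bool (?b x \<noteq> 1) + ennreal ((1 - \<pi>) * ?f (-1) x) * of_bool (?b x \<noteq> -1)
        \<le> ennreal (\<pi> * ?f 1 x) * of_bool (h x \<noteq> 1) + ennreal ((1 - \<pi>) * ?f (-1) x) * of_bool (h x \<noteq> -1)"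
      using pos neg by (auto intro: ennreal_leI)
  qed
  then show ?thesis by (simp add: SR_nonneg)
qed

section \<open>Linear classifiers\<close>

text \<open>Error probability of a half-space classifier in normalised form: \<open>a\<close> is the
  signed length of the projection of the mean on the unit normal, reduced by the cap distance in the
  robust case, and \<open>c\<close> is the threshold divided by the norm of the weight.\<close>

definition linear_risk :: "real \<Rightarrow> real \<Rightarrow> real \<Rightarrow> real" where
  "linear_risk \<pi> a c = \<pi> * Phi (c - a) + (1 - \<pi>) * Phi (- c - a)"

lemma SR_linear:
  assumes \<pi>: "0 < \<pi>" "\<pi> < 1" and s0: "s\<^sub>0 \<in> {-1, 1}" and w: "vnorm d w > 0"
  shows "SR d \<pi> \<mu> (\<lambda>x. sign s\<^sub>0 (vinner d w x - c)) = linear_risk \<pi> (vinner d w \<mu> / vnorm d w) (c / vnorm d w)"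
proof -
  let ?h = "\<lambda>x. sign s\<^sub>0 (vinner d w x - c)"
  have sets: "{x \<in> vecs d. ?h x \<noteq> 1} = (if s\<^sub>0 = 1 then {x \<in> vecs d. vinner d w x < c} else {x \<in> vecs d. vinner d w x \<le> c})"
    "{x \<in> vecs d. ?h x \<noteq> -1} = (if s\<^sub>0 = 1 then {x \<in> vecs d. c \<le> vinner d w x} else {x \<in> vecs d. c < vinner d w x})"
    using s0 by (auto simp: sign_def)
  have "measure (gaussian_vec d (vscale d 1 \<mu>)) {x \<in> vecs d. ?h x \<noteq> 1} = Phi (c / vnorm d w - vinner d w \<mu> / vnorm d w)"
    unfolding sets by (simp add: gaussian_vec_halfspaces[OF w] vinner_vscale diff_divide_distrib algebra_simps)
  moreover have "measure (gaussian_vec d (vscale d (-1) \<mu>)) {x \<in> vecs d. ?h x \<noteq> -1} = Phi (- (c / vnorm d w) - vinner d w \<mu> / vnorm d w)"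
    unfolding sets by (simp add: gaussian_vec_halfspaces[OF w] vinner_vscale diff_divide_distrib minus_diff_commute)
  ultimately show ?thesis
    by (simp add: SR_eq[OF \<pi> classifier_error_sets[OF linear_classifier_measurable[OF s0]]] linear_risk_def)
qed

lemma SR_const:
  assumes \<pi>: "0 < \<pi>" "\<pi> < 1"
  shows "SR d \<pi> \<mu> (\<lambda>_. s) = \<pi> * of_bool (s \<noteq> 1) + (1 - \<pi>) * of_bool (s \<noteq> -1)"
proof -
  interpret P: prob_space "gaussian_vec d (vscale d 1 \<mu>)" by (rule prob_space_gaussian_vec)
  interpret N: prob_space "gaussian_vec d (vscale d (-1) \<mu>)" by (rule prob_space_gaussian_vec)
  have "P.prob (vecs d) = 1" "N.prob (vecs d) = 1"
    using P.prob_space N.prob_space by (simp_all add: space_gaussian_vec)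
  then show ?thesis by (subst SR_eq[OF \<pi>]) (auto simp: of_bool_def)
qed

lemma linear_risk_antimono:
  assumes "0 < \<pi>" "\<pi> < 1" "a \<le> b"
  shows "linear_risk \<pi> b c \<le> linear_risk \<pi> a c"
  unfolding linear_risk_def using assms by (intro add_mono mult_left_mono Phi_mono) auto

lemma linear_risk_lipschitz:
  assumes "0 < \<pi>" "\<pi> < 1" "a \<le> b"
  shows "linear_risk \<pi> a c \<le> linear_risk \<pi> b c + (b - a)"
proof -
  have "linear_risk \<pi> a c \<le> \<pi> * (Phi (c - b) + (b - a)) + (1 - \<pi>) * (Phi (- c - b) + (b - a))"
    unfolding linear_risk_def
    using assms Phi_lipschitz[of "c - b" "c - a"] Phi_lipschitz[of "- c - b" "- c - a"]
    by (intro add_mono mult_left_mono) auto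
  also have "\<dots> = linear_risk \<pi> b c + (b - a)"
    by (simp add: linear_risk_def algebra_simps)
  finally show ?thesis .
qed

lemma SR_h_Bayes_eq:
  assumes "0 < \<pi>" "\<pi> < 1" "s\<^sub>0 \<in> {-1, 1}" "vnorm d \<mu> > 0"
  shows "SR d \<pi> \<mu> (h_Bayes s\<^sub>0 d \<pi> \<mu>) = linear_risk \<pi> (vnorm d \<mu>) (log_odds \<pi> / 2 / vnorm d \<mu>)"
  using SR_linear[OF assms, of \<mu> "log_odds \<pi> / 2"] assms(4)
  by (simp add: h_Bayes_def[abs_def] vinner_commute vinner_self power2_eq_square)

text \<open>Avoids calculus: \<open>linear_risk \<pi> a\<close> is the standard risk in dimension
  one with mean \<open>a\<close>, so Bayes optimality against linear classifiers gives the first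
  claim and against the two constants the second. The second claim serves the weight
  \<open>w = 0\<close>.\<close>

lemma linear_risk_optimal:
  assumes \<pi>: "0 < \<pi>" "\<pi> < 1" and a: "a > 0"
  shows "linear_risk \<pi> a (log_odds \<pi> / 2 / a) \<le> linear_risk \<pi> a c"
    and "linear_risk \<pi> a (log_odds \<pi> / 2 / a) \<le> min \<pi> (1 - \<pi>)"
proof -
  define \<mu> where "\<mu> = (\<lambda>_::nat. a)"
  have \<mu>: "vnorm 1 \<mu> = a" using a by (simp add: L2_set_def \<mu>_def)
  have one: "(1::int) \<in> {-1, 1}" by simp
  have \<mu>_pos: "vnorm 1 \<mu> > 0" using \<mu> a by simp
  note Bayes = SR_h_Bayes_eq[OF \<pi> one \<mu>_pos, unfolded \<mu>] and le = SR_h_Bayes_le[OF \<pi> one, of _ 1 \<mu>]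
  \<comment> \<open>Weight \<open>a\<close> with threshold \<open>c * a\<close> normalises to
    threshold \<open>c\<close>, so every \<open>c\<close> is realised by a classifier.\<close>
  have "SR 1 \<pi> \<mu> (\<lambda>x. sign 1 (vinner 1 \<mu> x - c * a)) = linear_risk \<pi> a c"
    using SR_linear[OF \<pi> one \<mu>_pos, of \<mu> "c * a"] a unfolding \<mu>
    by (simp add: vinner_self \<mu> power2_eq_square del: One_nat_def)
  then show "linear_risk \<pi> a (log_odds \<pi> / 2 / a) \<le> linear_risk \<pi> a c"
    using le[OF linear_classifier_measurable[OF one]] Bayes by metis
  show "linear_risk \<pi> a (log_odds \<pi> / 2 / a) \<le> min \<pi> (1 - \<pi>)"
    using le[of "\<lambda>_. 1"] le[of "\<lambda>_. -1"] by (simp add: Bayes SR_const[OF \<pi>] del: One_nat_def)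
qed

lemma sign_diff_neq:
  assumes "s\<^sub>0 \<in> {-1, 1}"
  shows "sign s\<^sub>0 (r - t) \<noteq> 1 \<longleftrightarrow> r \<in> (if s\<^sub>0 = 1 then {..<t} else {..t})"
    and "sign s\<^sub>0 (r - t) \<noteq> - 1 \<longleftrightarrow> r \<in> (if s\<^sub>0 = 1 then {t..} else {t<..})"
  using assms by (auto simp: sign_def)

section \<open>The robust risk of linear classifiers and its minimiser\<close>

context perturbation
begin

lemma measure_pert_dist_vinner:
  assumes w: "vnorm d w > 0" and A: "A \<in> sets borel"
  shows "measure (pert_dist d \<epsilon>) {\<delta> \<in> vecs d. vinner d w \<delta> / vnorm d w \<in> A} = prob A"
proof -
  define u where "u = vscale d (1 / vnorm d w) w"
  have u: "vnorm d u = 1" using w by (simp add: u_def vnorm_vscale)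
  have u_vinner: "vinner d u \<delta> = vinner d w \<delta> / vnorm d w" for \<delta>
    by (simp add: u_def vinner_commute[of d _ \<delta>] vinner_vscale)
  have "prob A = measure (distr (pert_dist d \<epsilon>) borel (vinner d u)) A"
    by (simp add: distr_pert_dist_vinner[OF d u])
  also have "\<dots> = measure (pert_dist d \<epsilon>) (vinner d u -` A \<inter> vecs d)"
    using A by (subst measure_distr) (auto simp: space_pert_dist)
  also have "vinner d u -` A \<inter> vecs d = {\<delta> \<in> vecs d. vinner d w \<delta> / vnorm d w \<in> A}"
    by (auto simp: u_vinner)
  finally show ?thesis ..
qed

text \<open>Division by the positive norm keeps the sign, which leaves a half-line event for the
  normalised perturbation. Symmetry and the absence of atoms express each of the four possible
  half-lines by \<open>tail\<close>, so both values of \<open>s\<^sub>0\<close> give the same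
  result.\<close>

lemma misclassification_probability:
  fixes c :: real
  assumes s0: "s\<^sub>0 \<in> {-1, 1}" and w: "vnorm d w > 0"
  defines "h \<equiv> \<lambda>x. sign s\<^sub>0 (vinner d w x - c)"
  shows "measure (pert_dist d \<epsilon>) {\<delta> \<in> vecs d. h (vadd d x \<delta>) \<noteq> 1} = tail ((vinner d w x - c) / vnorm d w)"
    and "measure (pert_dist d \<epsilon>) {\<delta> \<in> vecs d. h (vadd d x \<delta>) \<noteq> - 1} = tail ((c - vinner d w x) / vnorm d w)"
proof -
  define t where "t = (c - vinner d w x) / vnorm d w"
  have t: "(vinner d w x - c) / vnorm d w = - t" by (simp add: t_def minus_divide_left)
  have h: "h (vadd d x \<delta>) = sign s\<^sub>0 (vinner d w \<delta> / vnorm d w - t)" for \<delta>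
  proof -
    have "vinner d w (vadd d x \<delta>) - c = vnorm d w * (vinner d w \<delta> / vnorm d w - t)"
      using w by (simp add: t_def vinner_vadd field_simps)
    then have "h (vadd d x \<delta>) = sign s\<^sub>0 (vnorm d w * (vinner d w \<delta> / vnorm d w - t))"
      by (simp only: h_def)
    then show ?thesis
      using w by (simp add: sign_def zero_less_mult_iff mult_less_0_iff)
  qed
  have "{\<delta> \<in> vecs d. h (vadd d x \<delta>) \<noteq> 1} =
      {\<delta> \<in> vecs d. vinner d w \<delta> / vnorm d w \<in> (if s\<^sub>0 = 1 then {..<t} else {..t})}"
    "{\<delta> \<in> vecs d. h (vadd d x \<delta>) \<noteq> - 1} =
      {\<delta> \<in> vecs d. vinner d w \<delta> / vnorm d w \<in> (if s\<^sub>0 = 1 then {t..} else {t<..})}"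
    by (simp_all only: h sign_diff_neq[OF s0])
  then show "measure (pert_dist d \<epsilon>) {\<delta> \<in> vecs d. h (vadd d x \<delta>) \<noteq> 1} = tail ((vinner d w x - c) / vnorm d w)"
    "measure (pert_dist d \<epsilon>) {\<delta> \<in> vecs d. h (vadd d x \<delta>) \<noteq> - 1} = tail ((c - vinner d w x) / vnorm d w)"
    unfolding t t_def[symmetric]
    by (simp_all add: measure_pert_dist_vinner[OF w] measure_greaterThan_eq_tail measure_atMost_eq_tail measure_lessThan_eq_tail
         del: greaterThan_iff atLeast_iff lessThan_iff atMost_iff)
qed

text \<open>By \<open>less_tail_iff\<close>, each robust error set is the half-space of ordinary
  errors with its boundary pushed outwards by the cap distance times \<open>vnorm d w\<close>. For
  both labels this acts like shortening the projected mean by the cap distance.\<close>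

lemma PR_linear:
  assumes \<pi>: "0 < \<pi>" "\<pi> < 1" and s0: "s\<^sub>0 \<in> {-1, 1}" and \<rho>: "\<rho> \<in> {0..1/2}" and w: "vnorm d w > 0"
  shows "PR d \<pi> \<epsilon> \<mu> (\<lambda>x. sign s\<^sub>0 (vinner d w x - c)) \<rho>
    = linear_risk \<pi> (vinner d w \<mu> / vnorm d w - cap_dist d \<epsilon> \<rho>) (c / vnorm d w)"
proof -
  let ?h = "\<lambda>x. sign s\<^sub>0 (vinner d w x - c)"
  define v where "v = cap_dist d \<epsilon> \<rho>"
  define E where "E y = {x \<in> vecs d. \<rho> < measure (pert_dist d \<epsilon>) {\<delta> \<in> vecs d. ?h (vadd d x \<delta>) \<noteq> y}}" for y
  have E1: "E 1 = {x \<in> vecs d. vinner d w x < c + vnorm d w * v}"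
    unfolding E_def misclassification_probability[OF s0 w] less_tail_iff[OF \<rho>] v_def[symmetric]
    using w by (auto simp: field_simps)
  have E2: "E (-1) = {x \<in> vecs d. c - vnorm d w * v < vinner d w x}"
    unfolding E_def misclassification_probability[OF s0 w] less_tail_iff[OF \<rho>] v_def[symmetric]
    using w by (auto simp: field_simps)
  \<comment> \<open>\<open>PR_eq\<close> asks for measurability at every integer label. For labels
    other than 1 and -1 the classifier always errs, with probability 1, which exceeds
    \<rho>.\<close>
  have E3: "E y = vecs d" if "y \<noteq> 1" "y \<noteq> -1" for y
  proof -
    interpret P: prob_space "pert_dist d \<epsilon>" using d \<epsilon> by (rule prob_space_pert_dist)
    have "{\<delta> \<in> vecs d. ?h (vadd d x \<delta>) \<noteq> y} = space (pert_dist d \<epsilon>)" for x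
      using s0 that by (auto simp: sign_def space_pert_dist)
    then show ?thesis using \<rho> by (auto simp: E_def P.prob_space)
  qed
  have "E y \<in> sets (lborel_vec d)" for y
  proof -
    consider "y = 1" | "y = -1" | "y \<noteq> 1" "y \<noteq> -1" by blast
    then show ?thesis by cases (simp_all add: E1 E2 E3)
  qed
  then have "PR d \<pi> \<epsilon> \<mu> ?h \<rho> = \<pi> * measure (gaussian_vec d (vscale d 1 \<mu>)) (E 1)
      + (1 - \<pi>) * measure (gaussian_vec d (vscale d (-1) \<mu>)) (E (-1))"
    unfolding E_def by (rule PR_eq[OF \<pi>])
  moreover have "measure (gaussian_vec d (vscale d 1 \<mu>)) (E 1) = Phi (c / vnorm d w - (vinner d w \<mu> / vnorm d w - v))"
    unfolding E1 gaussian_vec_halfspaces[OF w] vinner_vscale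
    using w by (intro arg_cong[where f=Phi]) (simp add: add_divide_distrib diff_divide_distrib)
  moreover have "measure (gaussian_vec d (vscale d (-1) \<mu>)) (E (-1)) = Phi (- (c / vnorm d w) - (vinner d w \<mu> / vnorm d w - v))"
    unfolding E2 gaussian_vec_halfspaces[OF w] vinner_vscale
    using w by (intro arg_cong[where f=Phi]) (simp add: add_divide_distrib diff_divide_distrib)
  ultimately show ?thesis by (simp add: linear_risk_def v_def)
qed

text \<open>Perturbations cannot change a constant prediction, so its error probability is 0 or 1,
  and \<rho> separates these values. This covers the weight \<open>w = 0\<close>.\<close>

lemma PR_const:
  assumes \<pi>: "0 < \<pi>" "\<pi> < 1" and \<rho>: "\<rho> \<in> {0..1/2}"
  shows "PR d \<pi> \<epsilon> \<mu> (\<lambda>_. s) \<rho> = SR d \<pi> \<mu> (\<lambda>_. s)"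
proof -
  interpret P: prob_space "pert_dist d \<epsilon>" using d \<epsilon> by (rule prob_space_pert_dist)
  have "measure (pert_dist d \<epsilon>) (vecs d) = 1"
    using P.prob_space by (simp add: space_pert_dist)
  then have "(\<rho> < measure (pert_dist d \<epsilon>) {\<delta> \<in> vecs d. s \<noteq> y}) = (s \<noteq> y)" for y
    using \<rho> by auto
  then show ?thesis
    by (subst PR_eq[OF \<pi>], simp, subst SR_eq[OF \<pi>]) simp_all
qed

text \<open>The cap distance is at most \<open>\<epsilon> < vnorm d \<mu>\<close>, so the factor in
  \<open>h_p\<close> is nonnegative and the truncation at 0 is inactive.\<close>

lemma h_p_eq_linear:
  assumes "\<epsilon> < vnorm d \<mu>" "\<rho> \<in> {0..1/2}"
  shows "h_p s\<^sub>0 d \<pi> \<epsilon> \<mu> \<rho>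
    = (\<lambda>x. sign s\<^sub>0 (vinner d (vscale d (1 - cap_dist d \<epsilon> \<rho> / vnorm d \<mu>) \<mu>) x - log_odds \<pi> / 2))"
proof -
  have "0 \<le> 1 - cap_dist d \<epsilon> \<rho> / vnorm d \<mu>"
    using cap_dist_properties[OF assms(2)] \<epsilon> assms(1) by (simp add: field_simps)
  then show ?thesis
    by (simp add: h_p_def[abs_def] vinner_commute[of d "vscale _ _ _"] vinner_vscale max_absorb2 mult.commute)
qed

text \<open>The weight vector is parallel to \<mu> and has norm exactly \<open>a\<close>, so the
  threshold \<open>log_odds \<pi> / 2\<close> normalises to the minimiser from
  \<open>linear_risk_optimal\<close>.\<close>

lemma PR_h_p:
  assumes \<pi>: "0 < \<pi>" "\<pi> < 1" and s0: "s\<^sub>0 \<in> {-1, 1}" and \<rho>: "\<rho> \<in> {0..1/2}" and \<mu>: "\<epsilon> < vnorm d \<mu>"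
  defines "a \<equiv> vnorm d \<mu> - cap_dist d \<epsilon> \<rho>"
  shows "PR d \<pi> \<epsilon> \<mu> (h_p s\<^sub>0 d \<pi> \<epsilon> \<mu> \<rho>) \<rho> = linear_risk \<pi> a (log_odds \<pi> / 2 / a)"
proof -
  define r where "r = 1 - cap_dist d \<epsilon> \<rho> / vnorm d \<mu>"
  have pos: "0 < vnorm d \<mu>" "cap_dist d \<epsilon> \<rho> < vnorm d \<mu>"
    using cap_dist_properties[OF \<rho>] \<epsilon> \<mu> by auto
  then have r: "0 < r" by (simp add: r_def)
  have norm: "vnorm d (vscale d r \<mu>) = a"
    using r pos by (simp add: vnorm_vscale a_def) (simp add: r_def field_simps)
  have a: "0 < a" using pos by (simp add: a_def)
  have "vinner d (vscale d r \<mu>) \<mu> = a * vnorm d \<mu>"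
    unfolding norm[symmetric] using r
    by (simp add: vinner_commute[of d "vscale _ _ _"] vinner_vscale vinner_self vnorm_vscale power2_eq_square)
  then show ?thesis
    using PR_linear[OF \<pi> s0 \<rho>, of "vscale d r \<mu>" \<mu> "log_odds \<pi> / 2"] a
    unfolding h_p_eq_linear[OF \<mu> \<rho>] r_def[symmetric] norm by (simp add: a_def)
qed

text \<open>For a nonzero weight, Cauchy-Schwarz bounds the projected mean by
  \<open>vnorm d \<mu>\<close>; monotonicity passes to this bound, and then the threshold is
  optimised. A zero weight gives a constant classifier, of risk \<open>\<pi>\<close> or
  \<open>1 - \<pi>\<close>.\<close>

lemma h_p_optimal:
  assumes \<pi>: "0 < \<pi>" "\<pi> < 1" and s0: "s\<^sub>0 \<in> {-1, 1}" and \<rho>: "\<rho> \<in> {0..1/2}" and \<mu>: "\<epsilon> < vnorm d \<mu>"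
  shows "is_arg_min (\<lambda>h. PR d \<pi> \<epsilon> \<mu> h \<rho>) (\<lambda>h. h \<in> linear_classifiers s\<^sub>0 d) (h_p s\<^sub>0 d \<pi> \<epsilon> \<mu> \<rho>)"
  unfolding is_arg_min_linorder
proof (intro conjI allI impI)
  show "h_p s\<^sub>0 d \<pi> \<epsilon> \<mu> \<rho> \<in> linear_classifiers s\<^sub>0 d"
    unfolding linear_classifiers_def h_p_eq_linear[OF \<mu> \<rho>] using vscale_vecs by blast
  fix h assume "h \<in> linear_classifiers s\<^sub>0 d"
  then obtain w c where h: "h = (\<lambda>x. sign s\<^sub>0 (vinner d w x - c))"
    by (auto simp: linear_classifiers_def)
  let ?a = "vnorm d \<mu> - cap_dist d \<epsilon> \<rho>"
  have a: "?a > 0" using cap_dist_properties[OF \<rho>] \<epsilon> \<mu> by auto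
  show "PR d \<pi> \<epsilon> \<mu> (h_p s\<^sub>0 d \<pi> \<epsilon> \<mu> \<rho>) \<rho> \<le> PR d \<pi> \<epsilon> \<mu> h \<rho>"
    unfolding PR_h_p[OF \<pi> s0 \<rho> \<mu>]
  proof (cases "vnorm d w = 0")
    case True
    have const: "h = (\<lambda>_. sign s\<^sub>0 (- c))" by (simp add: h vinner_eq_0[OF True])
    have "sign s\<^sub>0 (- c) \<in> {-1, 1}" using s0 by (auto simp: sign_def)
    then show "linear_risk \<pi> ?a (log_odds \<pi> / 2 / ?a) \<le> PR d \<pi> \<epsilon> \<mu> h \<rho>"
      using linear_risk_optimal(2)[OF \<pi> a] unfolding const PR_const[OF \<pi> \<rho>] SR_const[OF \<pi>] by auto
  next
    case False
    then have w: "vnorm d w > 0" using L2_set_nonneg[of w "{..<d}"] by linarith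
    have "vinner d w \<mu> / vnorm d w \<le> vnorm d \<mu>"
      using vinner_le_vnorm[of d w \<mu>] w by (simp add: divide_le_eq mult.commute)
    then have "linear_risk \<pi> ?a (c / vnorm d w) \<le> PR d \<pi> \<epsilon> \<mu> h \<rho>"
      unfolding h PR_linear[OF \<pi> s0 \<rho> w] by (intro linear_risk_antimono[OF \<pi>]) simp
    then show "linear_risk \<pi> ?a (log_odds \<pi> / 2 / ?a) \<le> PR d \<pi> \<epsilon> \<mu> h \<rho>"
      using linear_risk_optimal(1)[OF \<pi> a] by (rule order_trans[rotated])
  qed
qed

text \<open>Both risks are minima of \<open>linear_risk\<close> over the threshold, for projected
  means that differ by the cap distance. Using the optimal threshold of one problem as a competitor
  in the other, monotonicity yields a nonnegative difference and the Lipschitz bound the upper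
  estimate.\<close>

lemma PR_h_p_minus_SR_h_Bayes:
  assumes \<pi>: "0 < \<pi>" "\<pi> < 1" and s0: "s\<^sub>0 \<in> {-1, 1}" and \<rho>: "\<rho> \<in> {0..1/2}" and \<mu>: "\<epsilon> < vnorm d \<mu>"
  shows "\<bar>PR d \<pi> \<epsilon> \<mu> (h_p s\<^sub>0 d \<pi> \<epsilon> \<mu> \<rho>) \<rho> - SR d \<pi> \<mu> (h_Bayes s\<^sub>0 d \<pi> \<mu>)\<bar> \<le> cap_dist d \<epsilon> \<rho>"
proof -
  define b where "b = vnorm d \<mu>"
  define a where "a = b - cap_dist d \<epsilon> \<rho>"
  have ab: "0 < a" "a \<le> b" "b - a = cap_dist d \<epsilon> \<rho>" "0 < b"
    using cap_dist_properties[OF \<rho>] \<epsilon> \<mu> by (auto simp: a_def b_def)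
  let ?c = "\<lambda>a. log_odds \<pi> / 2 / a"
  have "linear_risk \<pi> b (?c b) \<le> linear_risk \<pi> b (?c a)"
    using \<pi> ab(4) by (rule linear_risk_optimal)
  also have "\<dots> \<le> linear_risk \<pi> a (?c a)"
    using \<pi> ab(2) by (rule linear_risk_antimono)
  finally have lower: "linear_risk \<pi> b (?c b) \<le> linear_risk \<pi> a (?c a)" .
  have "linear_risk \<pi> a (?c a) \<le> linear_risk \<pi> a (?c b)"
    using \<pi> ab(1) by (rule linear_risk_optimal)
  also have "\<dots> \<le> linear_risk \<pi> b (?c b) + (b - a)"
    using \<pi> ab(2) by (rule linear_risk_lipschitz)
  finally show ?thesis
    using lower ab(3,4) PR_h_p[OF \<pi> s0 \<rho> \<mu>] SR_h_Bayes_eq[OF \<pi> s0 ab(4)[unfolded b_def]]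
    unfolding b_def[symmetric] a_def[symmetric] by simp
qed

end

section \<open>Optimality in every dimension and the rate as the dimension grows\<close>

theorem proposition4p1:
  fixes \<pi> \<epsilon> :: real and s\<^sub>0 :: int
  assumes "0 < \<pi>" and "\<pi> < 1" and "\<epsilon> > 0" and "s\<^sub>0 \<in> {-1, 1}"
  shows "(\<forall>d\<ge>1. \<forall>\<mu>\<in>vecs d. \<epsilon> < vnorm d \<mu> \<longrightarrow>
           (\<forall>\<rho>\<in>{0..1/2}.
              is_arg_min (\<lambda>h. PR d \<pi> \<epsilon> \<mu> h \<rho>) (\<lambda>h. h \<in> linear_classifiers s\<^sub>0 d)
                (h_p s\<^sub>0 d \<pi> \<epsilon> \<mu> \<rho>)))
       \<and> (\<forall>d\<ge>1. \<forall>\<mu>\<in>vecs d. \<epsilon> < vnorm d \<mu> \<longrightarrow>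
           is_arg_min (SR d \<pi> \<mu>) (\<lambda>h. h \<in> lborel_vec d \<rightarrow>\<^sub>M count_space {-1, 1})
             (h_Bayes s\<^sub>0 d \<pi> \<mu>))
       \<and> (\<forall>\<mu> :: nat \<Rightarrow> nat \<Rightarrow> real. (\<forall>d\<ge>1. \<mu> d \<in> vecs d \<and> \<epsilon> < vnorm d (\<mu> d)) \<longrightarrow>
           (\<forall>\<rho>\<in>{0<..1/2}.
              (\<lambda>d. PR d \<pi> \<epsilon> (\<mu> d) (h_p s\<^sub>0 d \<pi> \<epsilon> (\<mu> d) \<rho>) \<rho>
                     - SR d \<pi> (\<mu> d) (h_Bayes s\<^sub>0 d \<pi> (\<mu> d)))
                \<in> O(\<lambda>d. 1 / sqrt (real d))) \<and>
           (\<lambda>d. PR d \<pi> \<epsilon> (\<mu> d) (h_p s\<^sub>0 d \<pi> \<epsilon> (\<mu> d) 0) 0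
                  - SR d \<pi> (\<mu> d) (h_Bayes s\<^sub>0 d \<pi> (\<mu> d)))
             \<in> O(\<lambda>d. 1))"
proof (intro conjI allI ballI impI)
  note \<pi> = assms(1,2) and \<epsilon> = assms(3) and s0 = assms(4)
  have pert: "perturbation d \<epsilon>" if "d \<ge> 1" for d
    using that \<epsilon> by unfold_locales
  fix d :: nat and \<mu> :: "nat \<Rightarrow> real" and \<rho> :: real
  assume "1 \<le> d" "\<epsilon> < vnorm d \<mu>" "\<rho> \<in> {0..1/2}"
  then show "is_arg_min (\<lambda>h. PR d \<pi> \<epsilon> \<mu> h \<rho>) (\<lambda>h. h \<in> linear_classifiers s\<^sub>0 d) (h_p s\<^sub>0 d \<pi> \<epsilon> \<mu> \<rho>)"
    using perturbation.h_p_optimal[OF pert \<pi> s0] by blast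
next
  fix d :: nat and \<mu> :: "nat \<Rightarrow> real"
  show "is_arg_min (SR d \<pi> \<mu>) (\<lambda>h. h \<in> lborel_vec d \<rightarrow>\<^sub>M count_space {-1, 1}) (h_Bayes s\<^sub>0 d \<pi> \<mu>)"
    unfolding is_arg_min_linorder
    using h_Bayes_measurable[OF assms(4)] SR_h_Bayes_le[OF assms(1,2,4)] by blast
next
  fix \<mu> :: "nat \<Rightarrow> nat \<Rightarrow> real"
  assume \<mu>: "\<forall>d\<ge>1. \<mu> d \<in> vecs d \<and> \<epsilon> < vnorm d (\<mu> d)"
  let ?D = "\<lambda>\<rho> d. PR d \<pi> \<epsilon> (\<mu> d) (h_p s\<^sub>0 d \<pi> \<epsilon> (\<mu> d) \<rho>) \<rho> - SR d \<pi> (\<mu> d) (h_Bayes s\<^sub>0 d \<pi> (\<mu> d))"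
  have pert: "perturbation d \<epsilon>" if "d \<ge> 1" for d
    using that assms(3) by unfold_locales
  have D: "\<bar>?D \<rho> d\<bar> \<le> cap_dist d \<epsilon> \<rho>" if "d \<ge> 1" "\<rho> \<in> {0..1/2}" for d \<rho>
    using that \<mu> by (intro perturbation.PR_h_p_minus_SR_h_Bayes[OF pert assms(1,2,4)]) auto
  show "?D 0 \<in> O(\<lambda>d. 1)"
  \<comment> \<open>The cap distance is at most \<epsilon> in every dimension; dimension 0, where
    \<open>\<mu>\<close> is unconstrained, is left out by arguing eventually.\<close>
  proof (rule bigoI[where c=\<epsilon>])
    show "\<forall>\<^sub>F d in sequentially. norm (?D 0 d) \<le> \<epsilon> * norm (1 :: real)"
      using eventually_ge_at_top[of 1]
    proof eventually_elim
      case (elim d)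
      then show ?case
        using D[of d 0] perturbation.cap_dist_properties[OF pert, of d 0] by simp
    qed
  qed
  fix \<rho> :: real assume "\<rho> \<in> {0<..1/2}"
  then have \<rho>: "\<rho> > 0" "\<rho> \<in> {0..1/2}" by auto
  show "?D \<rho> \<in> O(\<lambda>d. 1 / sqrt (real d))"
  \<comment> \<open>Solving \<open>d * \<rho> * v\<^sup>2 \<le> \<epsilon>\<^sup>2\<close> for the
    cap distance \<open>v\<close> gives this constant.\<close>
  proof (rule bigoI[where c="\<epsilon> / sqrt \<rho>"])
    show "\<forall>\<^sub>F d in sequentially. norm (?D \<rho> d) \<le> \<epsilon> / sqrt \<rho> * norm (1 / sqrt (real d))"
      using eventually_ge_at_top[of 1]
    proof eventually_elim
      case (elim d)
      let ?v = "cap_dist d \<epsilon> \<rho>"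
      have "(sqrt d * sqrt \<rho> * ?v)\<^sup>2 \<le> \<epsilon>\<^sup>2"
        using perturbation.cap_dist_sq_le[OF pert[OF elim] \<rho>(2)] \<rho>(1) by (simp add: power_mult_distrib)
      then have "sqrt d * sqrt \<rho> * ?v \<le> \<epsilon>"
        using assms(3) by (rule power2_le_imp_le[OF _ less_imp_le])
      then have "?v \<le> \<epsilon> / sqrt \<rho> * (1 / sqrt (real d))"
        using \<rho>(1) elim by (simp add: field_simps)
      then show ?case using D[OF elim \<rho>(2)] by simp
    qed
  qed
qed

end
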